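(* For every integer $r \geq 1$, $$\lim_{n\to\infty} n^{r-1/2}\,(-1)^{r-1}\Delta^r\log\overline{p}(n)=\frac{\pi}{2}\Bigl(\frac12\Bigr)_{r-1}.$$
   Context: An overpartition of a positive integer $n$ is a nonincreasing sequence of positive integers with sum $n$ in which the first occurrence of each number may be overlined. $\overline{p}(n)$ denotes the number of overpartitions of $n$, with $\overline{p}(0)=1$. $\Delta$ is the forward difference operator $\Delta f(n)=f(n+1)-f(n)$ and $\Delta^r$ is its $r$-fold iterate (acting in $n$). $\log$ is the natural logarithm. The rising factorial is $(\alpha)_m=\alpha(\alpha+1)\cdots(\alpha+m-1)$, with $(\alpha)_0=1$. The limit is over positive integers $n$. *)

theory Defs
  imports "HOL-Analysis.Analysis"
begin

text \<open>An overpartition is a list of pairs (part, flag); the flag is true iff the part is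
  overlined, which is only allowed at the first occurrence of that part.\<close>

definition overpartitions :: "nat \<Rightarrow> (nat \<times> bool) list set" where
  "overpartitions n = {xs.
     sorted_wrt (\<ge>) (map fst xs) \<and>
     (\<forall>x\<in>set xs. 0 < fst x) \<and>
     sum_list (map fst xs) = n \<and>
     (\<forall>i<length xs. snd (xs ! i) \<longrightarrow> (\<forall>j<i. fst (xs ! j) \<noteq> fst (xs ! i)))}"

definition overp :: "nat \<Rightarrow> nat" where
  "overp n = card (overpartitions n)"

definition fwd_diff :: "(nat \<Rightarrow> 'a::ab_group_add) \<Rightarrow> nat \<Rightarrow> 'a" where
  "fwd_diff f n = f (n + 1) - f n"

lemma finite_overpartitions: "finite (overpartitions n)"
proof (rule finite_subset)
  show "overpartitions n \<subseteq> {xs. set xs \<subseteq> {..n} \<times> UNIV \<and> length xs \<le> n}"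
  proof
    fix xs assume "xs \<in> overpartitions n"
    then have pos: "\<forall>x\<in>set xs. 0 < fst x" and s: "sum_list (map fst xs) = n"
      by (auto simp: overpartitions_def)
    have "length xs \<le> sum_list (map fst xs)"
      using pos by (induction xs) auto
    moreover have "fst x \<le> n" if "x \<in> set xs" for x
      using that s member_le_sum_list[of "fst x" "map fst xs"] by auto
    ultimately show "xs \<in> {xs. set xs \<subseteq> {..n} \<times> UNIV \<and> length xs \<le> n}"
      using s by auto
  qed
  show "finite {xs :: (nat \<times> bool) list. set xs \<subseteq> {..n} \<times> UNIV \<and> length xs \<le> n}"
    by (rule finite_lists_length_le) auto
qed

lemma overp_0: "overp 0 = 1"
proof -
  have "overpartitions 0 = {[]}"
    by (auto simp: overpartitions_def neq_Nil_conv) (metis list.set_intros(1) fst_conv less_irrefl neq_Nil_conv surj_pair)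
  then show ?thesis by (simp add: overp_def)
qed

lemma overp_pos: "0 < overp n"
proof -
  have "(if n = 0 then [] else [(n, False)]) \<in> overpartitions n"
    by (auto simp: overpartitions_def)
  then show ?thesis
    unfolding overp_def using finite_overpartitions card_gt_0_iff by blast
qed

end

theory Submission
  imports Defs "HOL-Complex_Analysis.Complex_Analysis" "HOL-Probability.Probability"
    "HOL-Real_Asymp.Real_Asymp"
begin

text \<open>The generating function of the overpartition numbers is the product of
  \<open>(1 + q ^ n) / (1 - q ^ n)\<close>, which by an identity of Gauss is the reciprocal of the theta series
  \<open>\<Sum>\<^sub>j (-1) ^ j * q ^ j\<^sup>2\<close>. The theta transformation describes it near \<open>q = 1\<close> with a bounded
  error, and the product shows that it is exponentially smaller on the rest of the circle. In
  Cauchy's integral the main term has an explicit primitive, whence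
  \<open>exp (pi * sqrt n) / (8 * n) * (1 - 1 / (pi * sqrt n))\<close> approximates the number of overpartitions of
  \<open>n\<close> with an exponentially small relative error. Its logarithm is \<open>pi * sqrt n - ln (8 * n)\<close> plus a
  power series in \<open>1 / sqrt n\<close>; by the mean value theorem only \<open>pi * sqrt n\<close> contributes to the limit.\<close>

section \<open>The product formula for the generating function\<close>

text \<open>The obstacle is that differencing gains a factor 1/n per step only on terms whose
  regularity in \<open>n\<close> is known; an error of unknown shape merely keeps its size. The
  \<open>r\<close>-th difference has order n^(1/2 - r) with \<open>r\<close> arbitrary, so no
  formula with a fixed power saving would do, and an exponentially small error settles all
  \<open>r\<close> at once. The exponent pi^2 / (4 z) + n z has its saddle at z = pi / (2 sqrt n),
  with value pi sqrt n. The weight sqrt z in front makes the integral, up to exponentially small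
  terms, a Bessel function of half-integral order, hence elementary: the main term is the growing
  part of the derivative in n of sinh (pi sqrt n) / (2 pi sqrt n), which is where 1 - 1 / (pi sqrt
  n) comes from. No contour is deformed; a primitive is evaluated at the two ends of a segment.
  Gauss's identity and the theta transformation are proved for real arguments only, and the
  resulting relation is continued analytically to the half-plane.\<close>

definition overpartitions_le :: "nat \<Rightarrow> nat \<Rightarrow> (nat \<times> bool) list set" where
  "overpartitions_le m k = {xs \<in> overpartitions k. \<forall>x\<in>set xs. fst x \<le> m}"

text \<open>The stage between parts below \<open>m\<close> and parts up to \<open>m\<close>: the
  part \<open>m\<close> may be repeated, but only plain. It separates the numerator 1 + q^m of the
  new factor from its denominator 1 - q^m.\<close>

definition plain_top :: "nat \<Rightarrow> nat \<Rightarrow> (nat \<times> bool) list set" where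
  "plain_top m k = {xs \<in> overpartitions_le m k. (m, True) \<notin> set xs}"

lemma Nil_in_overpartitions: "[] \<in> overpartitions k \<longleftrightarrow> k = 0"
  by (auto simp: overpartitions_def)

text \<open>This turns the index condition on the flags into a recursion on lists: the head is
  always a first occurrence, so its own flag is free, while an overlined \<open>p\<close> further
  down would no longer be the first.\<close>

lemma Cons_in_overpartitions:
  "(p, b) # xs \<in> overpartitions k \<longleftrightarrow>
     0 < p \<and> p \<le> k \<and> xs \<in> overpartitions (k - p) \<and> (\<forall>x\<in>set xs. fst x \<le> p) \<and> (p, True) \<notin> set xs"
proof -
  have flags: "(\<forall>i<length ((p, b) # xs). snd (((p, b) # xs) ! i) \<longrightarrow>
                 (\<forall>j<i. fst (((p, b) # xs) ! j) \<noteq> fst (((p, b) # xs) ! i))) \<longleftrightarrow>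
        (p, True) \<notin> set xs \<and>
        (\<forall>i<length xs. snd (xs ! i) \<longrightarrow> (\<forall>j<i. fst (xs ! j) \<noteq> fst (xs ! i)))"
    (is "?L \<longleftrightarrow> ?R1 \<and> ?R2")
  proof
    assume L: ?L
    have ?R1
    proof
      assume "(p, True) \<in> set xs"
      then obtain i where "i < length xs" "xs ! i = (p, True)" by (auto simp: in_set_conv_nth)
      with L[rule_format, of "Suc i" 0] show False by simp
    qed
    moreover have ?R2
      using L by (metis Suc_less_eq length_Cons nth_Cons_Suc)
    ultimately show "?R1 \<and> ?R2" ..
  next
    assume R: "?R1 \<and> ?R2"
    show ?L
    proof (intro allI impI)
      fix i j assume i: "i < length ((p, b) # xs)" "snd (((p, b) # xs) ! i)" "j < i"
      then obtain i' where i': "i = Suc i'" by (cases i) auto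
      with i have "xs ! i' \<in> set xs" "snd (xs ! i')" by auto
      with R have "fst (xs ! i') \<noteq> p" by (metis prod.collapse)
      with R i i' show "fst (((p, b) # xs) ! j) \<noteq> fst (((p, b) # xs) ! i)"
        by (cases j) auto
    qed
  qed
  show ?thesis unfolding overpartitions_def mem_Collect_eq flags by auto
qed

lemma finite_overpartitions_le [simp]: "finite (overpartitions_le m k)"
  using finite_overpartitions by (auto simp: overpartitions_le_def)

lemma finite_plain_top [simp]: "finite (plain_top m k)"
  by (auto simp: plain_top_def)

lemma overpartitions_le_0: "overpartitions_le 0 k = (if k = 0 then {[]} else {})"
proof -
  have "xs = []" if "xs \<in> overpartitions_le 0 k" for xs
    using that by (cases xs) (auto simp: overpartitions_le_def Cons_in_overpartitions)
  moreover have "[] \<in> overpartitions_le 0 k \<longleftrightarrow> k = 0"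
    by (simp add: overpartitions_le_def Nil_in_overpartitions)
  ultimately show ?thesis by (cases "k = 0") fastforce+
qed

lemma overpartitions_le_eq: "k \<le> m \<Longrightarrow> overpartitions_le m k = overpartitions k"
proof -
  assume "k \<le> m"
  have "fst x \<le> m" if "xs \<in> overpartitions k" "x \<in> set xs" for xs x
    using that \<open>k \<le> m\<close> member_le_sum_list[of "fst x" "map fst xs"]
    by (auto simp: overpartitions_def)
  then show ?thesis by (auto simp: overpartitions_le_def)
qed

text \<open>An overlined largest part must stand at the head, being a first occurrence in a
  nonincreasing list; what follows it belongs to the plain stage.\<close>

lemma overpartitions_le_Suc:
  "overpartitions_le (Suc m) k = plain_top (Suc m) k \<union>
     (#) (Suc m, True) ` (if Suc m \<le> k then plain_top (Suc m) (k - Suc m) else {})" (is "?A = ?B")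
proof (rule set_eqI)
  fix xs show "xs \<in> ?A \<longleftrightarrow> xs \<in> ?B"
  proof (cases xs)
    case Nil then show ?thesis by (auto simp: plain_top_def)
  next
    case (Cons x ys)
    obtain p b where x: "x = (p, b)" by (cases x)
    show ?thesis unfolding Cons x
      by (auto simp: plain_top_def overpartitions_le_def Cons_in_overpartitions)
  qed
qed

text \<open>Removing one plain head stays in the same stage, so the recursion runs in
  \<open>k\<close> and produces the geometric series 1 / (1 - q^(m+1)).\<close>

lemma plain_top_Suc:
  "plain_top (Suc m) k = overpartitions_le m k \<union>
     (#) (Suc m, False) ` (if Suc m \<le> k then plain_top (Suc m) (k - Suc m) else {})" (is "?A = ?B")
proof (rule set_eqI)
  fix xs show "xs \<in> ?A \<longleftrightarrow> xs \<in> ?B"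
  proof (cases xs)
    case Nil then show ?thesis by (auto simp: plain_top_def overpartitions_le_def)
  next
    case (Cons x ys)
    obtain p b where x: "x = (p, b)" by (cases x)
    show ?thesis
    proof (cases "p = Suc m")
      case True
      then show ?thesis unfolding Cons x
        by (auto simp: plain_top_def overpartitions_le_def Cons_in_overpartitions)
    next
      case False
      then have p: "p \<le> Suc m \<longleftrightarrow> p \<le> m" by auto
      have ys: "(\<forall>y\<in>set ys. fst y \<le> m) \<and> (\<forall>y\<in>set ys. fst y \<le> Suc m) \<and> (Suc m, True) \<notin> set ys"
        if "\<forall>y\<in>set ys. fst y \<le> p" "p \<le> m"
      proof -
        have "fst y \<le> m" if "y \<in> set ys" for y
          using that \<open>\<forall>y\<in>set ys. fst y \<le> p\<close> \<open>p \<le> m\<close> le_trans by blast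
        then show ?thesis by (metis fst_conv le_SucI not_less_eq_eq order_refl)
      qed
      have "(\<forall>y\<in>set ((p, b) # ys). fst y \<le> n) \<longleftrightarrow> p \<le> n \<and> (\<forall>y\<in>set ys. fst y \<le> n)" for n
        by simp
      moreover have "(Suc m, True) \<in> set ((p, b) # ys) \<longleftrightarrow> (Suc m, True) \<in> set ys"
        using False by simp
      ultimately have "xs \<in> plain_top (Suc m) k \<longleftrightarrow> xs \<in> overpartitions_le m k"
        using p ys unfolding Cons x plain_top_def overpartitions_le_def mem_Collect_eq
          Cons_in_overpartitions by blast
      moreover have "xs \<notin> (#) (Suc m, False) ` A" for A using False Cons x by auto
      ultimately show ?thesis by blast
    qed
  qed
qed

lemma card_overpartitions_le_Suc:
  "card (overpartitions_le (Suc m) k) = card (plain_top (Suc m) k) +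
     (if Suc m \<le> k then card (plain_top (Suc m) (k - Suc m)) else 0)"
  unfolding overpartitions_le_Suc
  by (subst card_Un_disjoint) (auto simp: plain_top_def card_image)

lemma card_plain_top_Suc:
  "card (plain_top (Suc m) k) = card (overpartitions_le m k) +
     (if Suc m \<le> k then card (plain_top (Suc m) (k - Suc m)) else 0)"
proof -
  have "overpartitions_le m k \<inter> (#) (Suc m, False) ` A = {}" for A
    by (auto simp: overpartitions_le_def)
  then have "card (overpartitions_le m k \<union> (#) (Suc m, False) ` A) = card (overpartitions_le m k) + card A"
    if "finite A" for A using that by (simp add: card_Un_disjoint card_image)
  from this[of "if Suc m \<le> k then plain_top (Suc m) (k - Suc m) else {}"] show ?thesis
    by (simp only: plain_top_Suc[of m k, symmetric]) simp
qed

section \<open>Finite products as generating functions, and their limit\<close>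

definition overp_prod :: "nat \<Rightarrow> 'a::field \<Rightarrow> 'a" where
  "overp_prod m q = (\<Prod>n=1..m. (1 + q ^ n) / (1 - q ^ n))"

lemma one_minus_power_nz:
  fixes q :: complex assumes "norm q < 1" "n > 0" shows "1 - q ^ n \<noteq> 0"
proof
  assume "1 - q ^ n = 0"
  then have "norm (q ^ n) = 1" by (simp add: eq_neg_iff_add_eq_0)
  moreover have "norm (q ^ n) < 1" using assms by (simp add: norm_power power_less_one_iff)
  ultimately show False by simp
qed

lemma overp_prod_has_fps_expansion:
  "(overp_prod m :: complex \<Rightarrow> complex) has_fps_expansion
     Abs_fps (\<lambda>k. of_nat (card (overpartitions_le m k)))"
proof (induction m)
  case 0
  have "Abs_fps (\<lambda>k. of_nat (card (overpartitions_le 0 k))) = (1 :: complex fps)"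
    by (rule fps_ext) (auto simp: overpartitions_le_0)
  moreover have "overp_prod 0 = (\<lambda>_. 1 :: complex)" by (auto simp: overp_prod_def)
  ultimately show ?case by simp
next
  case (Suc m)
  define F where "F = (\<lambda>m. Abs_fps (\<lambda>k. of_nat (card (overpartitions_le m k))) :: complex fps)"
  define U where "U = (Abs_fps (\<lambda>k. of_nat (card (plain_top (Suc m) k))) :: complex fps)"
  define X where "X = (fps_X ^ Suc m :: complex fps)"
  have 1: "F (Suc m) = (1 + X) * U"
    by (rule fps_ext)
       (simp add: F_def U_def X_def distrib_right fps_X_power_mult_nth card_overpartitions_le_Suc
          del: power_Suc)
  have "F m = U - X * U"
    by (rule fps_ext)
       (subst U_def, simp add: F_def U_def X_def fps_X_power_mult_nth card_plain_top_Suc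
          del: power_Suc)
  then have "F m = U * (1 - X)" by (simp add: algebra_simps)
  have X0: "fps_nth (1 - X) 0 \<noteq> 0" by (simp add: X_def)
  have "1 - X \<noteq> 0" using X0 by (metis fps_zero_nth)
  then have "U = F m / (1 - X)" using \<open>F m = U * (1 - X)\<close> by simp
  then have eq: "F (Suc m) = F m * ((1 + X) / (1 - X))"
    unfolding 1 using X0 by (simp add: fps_divide_unit mult_ac)
  have "(\<lambda>q. overp_prod m q * ((1 + q ^ Suc m) / (1 - q ^ Suc m))) has_fps_expansion
          F m * ((1 + X) / (1 - X))"
    unfolding F_def using X0 unfolding X_def
    by (intro has_fps_expansion_mult Suc has_fps_expansion_divide' has_fps_expansion_add
         has_fps_expansion_diff has_fps_expansion_1 has_fps_expansion_fps_X_power) auto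
  moreover have "(\<lambda>q. overp_prod m q * ((1 + q ^ Suc m) / (1 - q ^ Suc m))) = overp_prod (Suc m)"
    by (auto simp: overp_prod_def)
  ultimately show ?case using eq unfolding F_def by metis
qed

text \<open>The formal expansion only concerns a neighbourhood of 0; holomorphy of the finite
  product on the unit disc extends it to the whole disc.\<close>

lemma overp_prod_sums:
  fixes q :: complex assumes "norm q < 1"
  shows "(\<lambda>k. of_nat (card (overpartitions_le m k)) * q ^ k) sums overp_prod m q"
proof -
  have "overp_prod m holomorphic_on ball (0::complex) 1"
    unfolding overp_prod_def
    by (intro holomorphic_intros) (use one_minus_power_nz in auto)
  from holomorphic_power_series[OF this, of q] assms
  have "(\<lambda>n. (deriv ^^ n) (overp_prod m) 0 / fact n * q ^ n) sums overp_prod m q"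
    by simp
  moreover have "(deriv ^^ n) (overp_prod m) 0 / fact n = complex_of_nat (card (overpartitions_le m n))" for n
    using fps_nth_fps_expansion[OF overp_prod_has_fps_expansion, of m n] by simp
  ultimately show ?thesis by simp
qed

lemma overp_prod_sums_real:
  fixes r :: real assumes "0 \<le> r" "r < 1"
  shows "(\<lambda>k. of_nat (card (overpartitions_le m k)) * r ^ k) sums overp_prod m r"
proof -
  have "(\<lambda>k. of_nat (card (overpartitions_le m k)) * complex_of_real r ^ k) sums overp_prod m (of_real r)"
    using assms by (intro overp_prod_sums) auto
  also have "(\<lambda>k. of_nat (card (overpartitions_le m k)) * complex_of_real r ^ k) =
             (\<lambda>k. of_real (of_nat (card (overpartitions_le m k)) * r ^ k))" by auto
  also have "overp_prod m (complex_of_real r) = of_real (overp_prod m r)"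
    by (simp add: overp_prod_def)
  finally show ?thesis by (subst (asm) sums_of_real_iff)
qed

text \<open>The point is uniformity in \<open>m\<close>: it makes the series of \<open>overp\<close>
  converge, and later keeps q-Pochhammer products away from 0.\<close>

lemma overp_prod_bound:
  fixes r :: real assumes "0 \<le> r" "r < 1"
  shows "overp_prod m r \<le> exp (2 / (1 - r)\<^sup>2)"
proof -
  have "overp_prod m r \<le> (\<Prod>n=1..m. exp (2 / (1 - r) * r ^ n))"
    unfolding overp_prod_def
  proof (rule prod_mono, safe)
    fix n assume n: "n \<in> {1..m}"
    then have rn: "0 \<le> r ^ n" "r ^ n \<le> r"
      using assms power_decreasing[of 1 n r] by auto
    show "0 \<le> (1 + r ^ n) / (1 - r ^ n)" using rn assms by simp
    have "(1 + r ^ n) / (1 - r ^ n) = 1 + 2 * r ^ n / (1 - r ^ n)"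
      using rn assms by (simp add: field_simps)
    also have "\<dots> \<le> exp (2 * r ^ n / (1 - r ^ n))" by (rule exp_ge_add_one_self)
    also have "\<dots> \<le> exp (2 * r ^ n / (1 - r))"
      using rn assms by (simp add: frac_le)
    finally show "(1 + r ^ n) / (1 - r ^ n) \<le> exp (2 / (1 - r) * r ^ n)" by simp
  qed
  also have "\<dots> = exp (2 / (1 - r) * (\<Sum>n=1..m. r ^ n))"
    by (simp add: exp_sum sum_distrib_left)
  also have "\<dots> \<le> exp (2 / (1 - r) * (1 / (1 - r)))"
  proof -
    have "(\<Sum>n=1..m. r ^ n) \<le> (\<Sum>n<Suc m. r ^ n)"
      by (rule sum_mono2) (use assms in auto)
    also have "\<dots> \<le> (\<Sum>n. r ^ n)"
      by (rule sum_le_suminf) (use assms in \<open>auto intro: summable_geometric\<close>)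
    also have "\<dots> = 1 / (1 - r)" using assms by (intro suminf_geometric) auto
    finally have "(\<Sum>n=1..m. r ^ n) \<le> 1 / (1 - r)" .
    then have "2 / (1 - r) * (\<Sum>n=1..m. r ^ n) \<le> 2 / (1 - r) * (1 / (1 - r))"
      by (rule mult_left_mono) (use assms in auto)
    then show ?thesis by simp
  qed
  also have "\<dots> = exp (2 / (1 - r)\<^sup>2)" by (simp add: power2_eq_square)
  finally show ?thesis .
qed

lemma summable_overp:
  fixes r :: real assumes "0 \<le> r" "r < 1"
  shows "summable (\<lambda>k. real (overp k) * r ^ k)"
proof (rule summableI_nonneg_bounded)
  fix m
  \<comment> \<open>For k < m the restriction to parts at most \<open>m\<close> is void, so this is
    a partial sum of the series of \<open>overp_prod m\<close>.\<close>
  have "(\<Sum>k<m. real (overp k) * r ^ k) = (\<Sum>k<m. real (card (overpartitions_le m k)) * r ^ k)"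
    by (intro sum.cong) (auto simp: overp_def overpartitions_le_eq)
  also have "\<dots> \<le> (\<Sum>k. real (card (overpartitions_le m k)) * r ^ k)"
    using overp_prod_sums_real[OF assms, of m] assms
    by (intro sum_le_suminf) (auto simp: sums_iff)
  also have "\<dots> = overp_prod m r" using overp_prod_sums_real[OF assms, of m] by (simp add: sums_iff)
  also have "\<dots> \<le> exp (2 / (1 - r)\<^sup>2)" using assms by (rule overp_prod_bound)
  finally show "(\<Sum>k<m. real (overp k) * r ^ k) \<le> exp (2 / (1 - r)\<^sup>2)" .
qed (use assms in auto)

definition overp_gf :: "complex \<Rightarrow> complex" where
  "overp_gf q = (\<Sum>k. of_nat (overp k) * q ^ k)"

lemma summable_norm_overp_gf:
  "norm q < 1 \<Longrightarrow> summable (\<lambda>k. norm (of_nat (overp k) * q ^ k :: complex))"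
  using summable_overp[of "norm q"] by (simp add: norm_mult norm_power)

lemma overp_gf_sums: "norm q < 1 \<Longrightarrow> (\<lambda>k. of_nat (overp k) * q ^ k) sums overp_gf q"
  unfolding overp_gf_def by (rule summable_sums[OF summable_norm_cancel[OF summable_norm_overp_gf]])

text \<open>Tannery's theorem: each coefficient is eventually constant in \<open>m\<close>, and all
  are dominated by \<open>overp k\<close>.\<close>

lemma overp_prod_tendsto:
  fixes q :: complex assumes "norm q < 1"
  shows "(\<lambda>m. overp_prod m q) \<longlonglongrightarrow> overp_gf q"
proof -
  have "(\<lambda>m. \<Sum>k. of_nat (card (overpartitions_le m k)) * q ^ k) \<longlonglongrightarrow> overp_gf q"
    unfolding overp_gf_def
  proof (rule conjunct2[OF conjunct2[OF tannerys_theorem]])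
    show "summable (\<lambda>k. norm (of_nat (overp k) * q ^ k :: complex))"
      using assms by (rule summable_norm_overp_gf)
    show "\<forall>\<^sub>F (k, m) in at_top \<times>\<^sub>F sequentially.
        norm (of_nat (card (overpartitions_le m k)) * q ^ k) \<le> norm (of_nat (overp k) * q ^ k :: complex)"
      unfolding overp_def
      by (intro always_eventually)
         (auto simp: norm_mult overpartitions_le_def intro!: mult_right_mono card_mono finite_overpartitions)
    fix k
    show "(\<lambda>m. of_nat (card (overpartitions_le m k)) * q ^ k) \<longlonglongrightarrow> (of_nat (overp k) * q ^ k :: complex)"
      by (rule tendsto_eventually, rule eventually_mono[OF eventually_ge_at_top[of k]])
         (auto simp: overpartitions_le_eq overp_def)
  qed auto
  then show ?thesis using overp_prod_sums[OF assms] by (simp add: sums_iff)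
qed

section \<open>Gauss's product formula for the theta series\<close>

definition q_poch :: "real \<Rightarrow> nat \<Rightarrow> real" where
  "q_poch Q n = (\<Prod>k=1..n. (1 - Q ^ k))"

lemma q_poch_0 [simp]: "q_poch Q 0 = 1"
  and q_poch_Suc [simp]: "q_poch Q (Suc n) = q_poch Q n * (1 - Q ^ Suc n)"
  by (simp_all add: q_poch_def)

text \<open>The Gaussian binomial coefficient, given by its q-Pascal rule because that is exactly
  what the induction for \<open>q_binomial_theorem\<close> consumes.\<close>

fun q_binomial :: "real \<Rightarrow> nat \<Rightarrow> nat \<Rightarrow> real" where
  "q_binomial Q n 0 = 1"
| "q_binomial Q 0 (Suc k) = 0"
| "q_binomial Q (Suc n) (Suc k) = q_binomial Q n k + Q ^ Suc k * q_binomial Q n (Suc k)"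

lemma q_binomial_eq_0: "n < k \<Longrightarrow> q_binomial Q n k = 0"
  by (induction Q n k rule: q_binomial.induct) auto

lemma q_binomial_mult_q_poch:
  "k \<le> n \<Longrightarrow> q_binomial Q n k * (q_poch Q k * q_poch Q (n - k)) = q_poch Q n"
proof (induction Q n k rule: q_binomial.induct)
  case (3 Q n k)
  show ?case
  proof (cases "k = n")
    case True
    with 3 show ?thesis by (simp add: q_binomial_eq_0 flip: mult.assoc)
  next
    case False
    with 3 have "k < n" by simp
    then obtain d where n: "n = Suc (k + d)" using less_iff_Suc_add by auto
    define a where "a = q_binomial Q n k"
    define b where "b = q_binomial Q n (Suc k)"
    have 1: "a * (q_poch Q k * q_poch Q (Suc d)) = q_poch Q n"
      using 3 n unfolding a_def by (simp add: Suc_diff_le)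
    have 2: "b * (q_poch Q (Suc k) * q_poch Q d) = q_poch Q n"
      using 3 n unfolding b_def by simp
    have "(a + Q ^ Suc k * b) * (q_poch Q (Suc k) * q_poch Q (Suc d)) =
            a * (q_poch Q k * q_poch Q (Suc d)) * (1 - Q ^ Suc k)
            + Q ^ Suc k * (1 - Q ^ Suc d) * (b * (q_poch Q (Suc k) * q_poch Q d))"
      by (simp add: algebra_simps)
    also have "\<dots> = q_poch Q n * (1 - Q ^ Suc n)"
      unfolding 1 2 by (simp add: n algebra_simps power_add)
    finally show ?thesis
      unfolding a_def b_def by (simp add: n)
  qed
qed auto

text \<open>Splitting off the factor i = 0 leaves the product at \<open>x * Q\<close>, so the
  induction hypothesis must cover all \<open>x\<close>. The coefficients of both sides then match by
  the q-Pascal rule.\<close>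

lemma q_binomial_theorem:
  "(\<Prod>i<n. 1 + x * Q ^ i) = (\<Sum>k\<le>n. Q ^ (k choose 2) * q_binomial Q n k * x ^ k)"
proof (induction n arbitrary: x)
  case (Suc n)
  define c where "c = (\<lambda>k. Q ^ (k choose 2) * x ^ k)"
  have c_0: "c 0 = 1" by (simp add: c_def numeral_2_eq_2)
  have c_Suc: "c (Suc k) = c k * x * Q ^ k" for k
    by (simp add: c_def numeral_2_eq_2 power_add)
  have "(\<Prod>i<Suc n. 1 + x * Q ^ i) = (1 + x) * (\<Prod>i<n. 1 + (x * Q) * Q ^ i)"
    by (subst prod.lessThan_Suc_shift) (simp add: mult_ac)
  also have "\<dots> = (1 + x) * (\<Sum>k\<le>n. c k * Q ^ k * q_binomial Q n k)"
    unfolding Suc by (simp add: c_def power_mult_distrib mult_ac)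
  also have "\<dots> = (\<Sum>k\<le>n. c k * Q ^ k * q_binomial Q n k)
                   + (\<Sum>k\<le>n. c (Suc k) * q_binomial Q n k)"
    by (simp add: algebra_simps sum.distrib sum_distrib_left c_Suc)
  also have "(\<Sum>k\<le>n. c k * Q ^ k * q_binomial Q n k) =
             (\<Sum>k\<le>Suc n. c k * Q ^ k * q_binomial Q n k)"
    by (simp add: q_binomial_eq_0)
  also have "\<dots> = 1 + (\<Sum>k\<le>n. c (Suc k) * Q ^ Suc k * q_binomial Q n (Suc k))"
    by (subst sum.atMost_Suc_shift) (simp add: c_0)
  also have "\<dots> + (\<Sum>k\<le>n. c (Suc k) * q_binomial Q n k) =
             1 + (\<Sum>k\<le>n. c (Suc k) * q_binomial Q (Suc n) (Suc k))"
    by (simp add: sum.distrib algebra_simps)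
  also have "\<dots> = (\<Sum>k\<le>Suc n. c k * q_binomial Q (Suc n) k)"
    by (subst sum.atMost_Suc_shift) (simp add: c_0)
  finally show ?case by (simp add: c_def mult_ac)
qed (simp add: numeral_2_eq_2)

section \<open>The finite triple product at -1\<close>

definition odd_poch :: "real \<Rightarrow> nat \<Rightarrow> real" where
  "odd_poch q N = (\<Prod>i<N. (1 - q ^ (2 * i + 1)))"

lemma sum_atMost_double_centre:
  fixes g :: "nat \<Rightarrow> 'a::comm_monoid_add"
  shows "(\<Sum>k\<le>2 * N. g k) = g N + (\<Sum>j=1..N. g (N + j) + g (N - j))"
proof -
  have "{..2 * N} = insert N ({N+1..2*N} \<union> {..<N})" by auto
  then have "(\<Sum>k\<le>2 * N. g k) = g N + ((\<Sum>k=N+1..2*N. g k) + (\<Sum>k<N. g k))"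
    by (simp, subst sum.union_disjoint) auto
  also have "(\<Sum>k=N+1..2*N. g k) = (\<Sum>j=1..N. g (N + j))"
    by (rule sum.reindex_bij_witness[of _ "\<lambda>j. N + j" "\<lambda>k. k - N"]) auto
  also have "(\<Sum>k<N. g k) = (\<Sum>j=1..N. g (N - j))"
    by (rule sum.reindex_bij_witness[of _ "\<lambda>j. N - j" "\<lambda>k. N - k"]) auto
  finally show ?thesis by (simp add: sum.distrib)
qed

lemma prod_odd_powers: "(\<Prod>i<N. (q::real) ^ (2 * i + 1)) = q ^ N\<^sup>2"
proof (induction N)
  case (Suc N)
  have "(Suc N)\<^sup>2 = N\<^sup>2 + (2 * N + 1)" by (simp add: power2_eq_square)
  with Suc show ?case by (simp add: power_add)
qed auto

lemma q_poch_pos: "\<lbrakk>0 \<le> Q; Q < 1\<rbrakk> \<Longrightarrow> q_poch Q n > 0"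
  unfolding q_poch_def by (intro prod_pos) (simp add: power_less_one_iff)

text \<open>The q-binomial theorem at \<open>x = - q / q ^ (2 * N)\<close>, with base \<open>q\<^sup>2\<close>: the finite form of
  the Jacobi triple product at the point -1.\<close>

lemma odd_poch_square:
  fixes q :: real assumes q: "0 < q" "q < 1"
  shows "(odd_poch q N)\<^sup>2 = q_poch (q\<^sup>2) (2 * N) / (q_poch (q\<^sup>2) N)\<^sup>2 +
           2 * (\<Sum>j=1..N. (-1) ^ j * q ^ j\<^sup>2 *
             (q_poch (q\<^sup>2) (2 * N) / (q_poch (q\<^sup>2) (N + j) * q_poch (q\<^sup>2) (N - j))))"
proof -
  define P where "P = q_poch (q\<^sup>2)"
  define x where "x = - q / q ^ (2 * N)"
  define b where "b = q_binomial (q\<^sup>2) (2 * N)"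
  define g where "g = (\<lambda>k. (q\<^sup>2) ^ (k choose 2) * b k * x ^ k)"
  have P_pos: "P n > 0" for n
    unfolding P_def by (rule q_poch_pos) (use q in \<open>auto simp: power_less_one_iff\<close>)
  have b: "b k = P (2 * N) / (P k * P (2 * N - k))" if "k \<le> 2 * N" for k
    using q_binomial_mult_q_poch[OF that, of "q\<^sup>2"] P_pos[of k] P_pos[of "2 * N - k"]
    unfolding b_def P_def by (simp add: field_simps)
  have choose: "2 * (k choose 2) + k = k\<^sup>2" for k :: nat
    by (induction k) (auto simp: numeral_2_eq_2 algebra_simps)
  \<comment> \<open>The exponent is k^2 - 2 N k = (k - N)^2 - N^2, a complete square up to a
    constant; this is why the sum is then folded about k = N.\<close>
  have g: "g k = b k * ((-1) ^ k * (q ^ k\<^sup>2 / q ^ (2 * N * k)))" for k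
  proof -
    have "(q\<^sup>2) ^ (k choose 2) * q ^ k = q ^ k\<^sup>2"
      unfolding choose[of k, symmetric] by (simp add: power_add power_mult)
    moreover have "x ^ k = (-1) ^ k * (q ^ k / q ^ (2 * N * k))"
      by (simp add: x_def power_divide power_mult power_minus')
    ultimately show ?thesis by (simp add: g_def mult_ac)
  qed
  have "(\<Prod>i<2 * N. 1 + x * (q\<^sup>2) ^ i) = (\<Sum>k\<le>2 * N. g k)"
    unfolding q_binomial_theorem g_def b_def ..
  also have "\<dots> = g N + (\<Sum>j=1..N. g (N + j) + g (N - j))"
    by (rule sum_atMost_double_centre)
  also have "g N = (-1) ^ N / q ^ N\<^sup>2 * (P (2 * N) / (P N)\<^sup>2)"
  proof -
    have "q ^ (2 * N * N) = q ^ N\<^sup>2 * q ^ N\<^sup>2"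
      by (simp add: power2_eq_square mult_2 distrib_right power_add)
    then show ?thesis unfolding g using q by (simp add: b power2_eq_square, simp add: mult_ac)
  qed
  also have "(\<Sum>j=1..N. g (N + j) + g (N - j)) =
             (\<Sum>j=1..N. (-1) ^ N / q ^ N\<^sup>2 * (2 * ((-1) ^ j * q ^ j\<^sup>2 *
                (P (2 * N) / (P (N + j) * P (N - j))))))"
  proof (rule sum.cong)
    fix j assume j: "j \<in> {1..N}"
    then obtain d where N: "N = j + d" using le_Suc_ex by auto
    have 1: "(N + j)\<^sup>2 + N\<^sup>2 = 2 * N * (N + j) + j\<^sup>2"
      by (simp add: power2_eq_square algebra_simps)
    have 2: "(N - j)\<^sup>2 + N\<^sup>2 = 2 * N * (N - j) + j\<^sup>2"
      by (simp add: N power2_eq_square algebra_simps)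
    have e1: "q ^ (N + j)\<^sup>2 / q ^ (2 * N * (N + j)) = q ^ j\<^sup>2 / q ^ N\<^sup>2"
      using q arg_cong[OF 1, of "\<lambda>n. q ^ n"] by (simp add: field_simps power_add)
    have e2: "q ^ (N - j)\<^sup>2 / q ^ (2 * N * (N - j)) = q ^ j\<^sup>2 / q ^ N\<^sup>2"
      using q arg_cong[OF 2, of "\<lambda>n. q ^ n"] by (simp add: field_simps power_add)
    have s: "(-1) ^ (N + j) = (-1) ^ N * (-1 :: real) ^ j" "(-1) ^ (N - j) = (-1) ^ N * (-1 :: real) ^ j"
      by (simp_all add: N power_add power_even_eq flip: mult_2)
    have "2 * N - (N + j) = N - j" "2 * N - (N - j) = N + j" using j by auto
    then have "b (N + j) = P (2 * N) / (P (N + j) * P (N - j))"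
      and "b (N - j) = P (2 * N) / (P (N + j) * P (N - j))"
      using j by (subst b; simp add: mult.commute)+
    then show "g (N + j) + g (N - j) = (-1) ^ N / q ^ N\<^sup>2 * (2 * ((-1) ^ j * q ^ j\<^sup>2 *
                (P (2 * N) / (P (N + j) * P (N - j)))))"
      unfolding g e1 e2 s by (simp, simp add: mult_ac)
  qed auto
  finally have rhs: "(\<Prod>i<2 * N. 1 + x * (q\<^sup>2) ^ i) = (-1) ^ N / q ^ N\<^sup>2 *
      (P (2 * N) / (P N)\<^sup>2 + 2 * (\<Sum>j=1..N. (-1) ^ j * q ^ j\<^sup>2 *
             (P (2 * N) / (P (N + j) * P (N - j)))))"
    by (simp only: sum_distrib_left distrib_left)
  \<comment> \<open>The factors are 1 - q^(2 i + 1 - 2 N). The upper half has positive odd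
    exponents; the lower half, read backwards, has their negatives, and 1 - q^(-a) = -(1 - q^a) /
    q^a yields the same product times the prefactor already found on the other side.\<close>
  have "(\<Prod>i<2 * N. 1 + x * (q\<^sup>2) ^ i) =
        (\<Prod>i<N. 1 + x * (q\<^sup>2) ^ i) * (\<Prod>i=N..<2 * N. 1 + x * (q\<^sup>2) ^ i)"
    by (subst prod.atLeastLessThan_concat[of 0 N "2 * N", symmetric, folded lessThan_atLeast0]) auto
  also have "(\<Prod>i=N..<2 * N. 1 + x * (q\<^sup>2) ^ i) = odd_poch q N"
    unfolding odd_poch_def
  proof (rule prod.reindex_bij_witness[of _ "\<lambda>i. i + N" "\<lambda>i. i - N"])
    fix i assume i: "i \<in> {N..<2 * N}"
    then obtain d where d: "i = N + d" using le_Suc_ex by auto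
    show "1 - q ^ (2 * (i - N) + 1) = 1 + x * (q\<^sup>2) ^ i"
      using q by (simp add: d x_def power_add power_mult)
  qed auto
  also have "(\<Prod>i<N. 1 + x * (q\<^sup>2) ^ i) = (\<Prod>i<N. - (1 - q ^ (2 * i + 1)) / q ^ (2 * i + 1))"
  proof (rule prod.reindex_bij_witness[of _ "\<lambda>i. N - Suc i" "\<lambda>i. N - Suc i"])
    fix i assume i: "i \<in> {..<N}"
    then obtain d where d: "N = Suc (i + d)" using less_iff_Suc_add by auto
    show "- (1 - q ^ (2 * (N - Suc i) + 1)) / q ^ (2 * (N - Suc i) + 1) = 1 + x * (q\<^sup>2) ^ i"
      using q by (simp add: d x_def power_add power_mult[symmetric] field_simps)
  qed auto
  also have "\<dots> = (-1) ^ N / q ^ N\<^sup>2 * odd_poch q N"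
    by (simp only: prod_dividef prod_odd_powers prod_uminus card_lessThan odd_poch_def) simp
  finally have "(-1) ^ N / q ^ N\<^sup>2 * (odd_poch q N)\<^sup>2 = (\<Prod>i<2 * N. 1 + x * (q\<^sup>2) ^ i)"
    by (simp add: power2_eq_square)
  with rhs show ?thesis unfolding P_def using q by simp
qed

lemma q_poch_double: "q_poch q (2 * N) = odd_poch q N * q_poch (q\<^sup>2) N"
proof (induction N)
  case (Suc N)
  have "(q\<^sup>2) ^ Suc N = q ^ Suc (Suc (2 * N))"
    by (simp only: power_mult[symmetric]) simp
  moreover have "2 * Suc N = Suc (Suc (2 * N))" by simp
  ultimately show ?case using Suc
    by (simp add: odd_poch_def mult_ac del: power_Suc)
qed (simp add: odd_poch_def)

text \<open>Combined with \<open>odd_poch_square\<close>, this makes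
  \<open>overp_prod (2 * N) q\<close> times a weighted finite theta sum exactly 1, so that a single
  passage to the limit remains.\<close>

lemma overp_prod_mult_odd_poch:
  fixes q :: real assumes q: "0 < q" "q < 1"
  shows "overp_prod (2 * N) q * (odd_poch q N * q_poch (q\<^sup>2) N)\<^sup>2 = q_poch (q\<^sup>2) (2 * N)"
proof -
  have "q_poch q m \<noteq> 0" for m using q_poch_pos[of q m] q by auto
  moreover have "overp_prod m q = (\<Prod>n=1..m. 1 + q ^ n) / q_poch q m" for m
    by (simp add: overp_prod_def q_poch_def prod_dividef)
  moreover have "(\<Prod>n=1..m. 1 + q ^ n) * q_poch q m = q_poch (q\<^sup>2) m" for m
    by (simp add: q_poch_def flip: prod.distrib) 
       (simp add: algebra_simps power2_eq_square power_mult_distrib)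
  ultimately have "overp_prod (2 * N) q * (q_poch q (2 * N))\<^sup>2 = q_poch (q\<^sup>2) (2 * N)"
    by (metis (no_types, lifting) nonzero_eq_divide_eq power2_eq_square mult.assoc)
  then show ?thesis by (simp add: q_poch_double)
qed

section \<open>The theta series as reciprocal of the generating function\<close>

definition theta4 :: "'a \<Rightarrow> 'a::{banach,real_normed_field}" where
  "theta4 q = 1 + 2 * (\<Sum>j. (-1) ^ Suc j * q ^ (Suc j)\<^sup>2)"

lemma power_Suc_square_le:
  fixes r :: real assumes "0 \<le> r" "r \<le> 1"
  shows "r ^ (Suc j)\<^sup>2 \<le> r ^ j"
  by (rule power_decreasing) (use assms in \<open>auto simp: power2_eq_square\<close>)

text \<open>The identity holds exactly at every finite \<open>N\<close>, where the
  \<open>j\<close>-th theta term carries the weight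
  \<open>(P N)\<^sup>2 / (P (N + j) * P (N - j))\<close>. Since \<open>P\<close> converges to a
  nonzero limit, the weights tend to 1, and Tannery's theorem applies.\<close>

theorem overp_gf_times_theta4_real:
  fixes q :: real assumes q: "0 < q" "q < 1"
  shows "overp_gf (of_real q) * of_real (theta4 q) = 1"
proof -
  define P where "P = q_poch (q\<^sup>2)"
  \<comment> \<open>A lower bound for all \<open>P n\<close>: the reciprocal of \<open>P n\<close>
    is at most \<open>overp_prod n (q\<^sup>2)\<close>, for which a bound uniform in
    \<open>n\<close> is known.\<close>
  define L where "L = exp (- (2 / (1 - q\<^sup>2)\<^sup>2))"
  have Q: "0 \<le> q\<^sup>2" "q\<^sup>2 < 1" using q by (auto simp: power_less_one_iff)
  have P_pos: "P n > 0" for n unfolding P_def using Q by (rule q_poch_pos)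
  have P_dec: "decseq P"
    unfolding P_def using Q P_pos[unfolded P_def]
    by (intro decseq_SucI) (auto intro!: mult_left_le simp: less_imp_le)
  have P_le1: "P n \<le> 1" for n using P_dec[unfolded decseq_def, rule_format, of 0 n] by (simp add: P_def)
  have P_ge: "L \<le> P n" for n
  proof -
    have "1 / P n \<le> overp_prod n (q\<^sup>2)"
      unfolding P_def q_poch_def overp_prod_def using Q
      by (subst prod_dividef[symmetric, where f = "\<lambda>_. 1", simplified], intro prod_mono)
         (auto intro!: divide_right_mono simp: power_le_one)
    also have "\<dots> \<le> exp (2 / (1 - q\<^sup>2)\<^sup>2)" using Q by (rule overp_prod_bound)
    finally show ?thesis using P_pos[of n] by (simp add: L_def exp_minus field_simps)
  qed
  have L: "L > 0" by (simp add: L_def)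
  obtain p where p: "P \<longlonglongrightarrow> p"
    using decseq_convergent[OF P_dec, of L] P_ge by blast
  have "p \<ge> L" using LIMSEQ_le_const[OF p] P_ge by blast
  then have p0: "p \<noteq> 0" using L by auto
  \<comment> \<open>The cut-off \<open>j < N\<close> makes the series finite and keeps
    \<open>N - Suc j\<close> from being truncated.\<close>
  define a where "a = (\<lambda>j N. if j < N then (-1) ^ Suc j * q ^ (Suc j)\<^sup>2 *
                         ((P N)\<^sup>2 / (P (N + Suc j) * P (N - Suc j))) else 0)"
  have "(\<lambda>N. \<Sum>j. a j N) \<longlonglongrightarrow> (\<Sum>j. (-1) ^ Suc j * q ^ (Suc j)\<^sup>2)"
  proof (rule conjunct2[OF conjunct2[OF tannerys_theorem]])
    show "summable (\<lambda>j. q ^ j * (1 / L))"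
      using q by (intro summable_mult2 summable_geometric) auto
    show "\<forall>\<^sub>F (j, N) in at_top \<times>\<^sub>F sequentially. norm (a j N) \<le> q ^ j * (1 / L)"
    proof (intro always_eventually, clarify)
      fix j N
      show "norm (a j N) \<le> q ^ j * (1 / L)"
      proof (cases "j < N")
        case True
        have "P N \<le> P (N - Suc j)" using P_dec by (simp add: decseq_def)
        then have "P N * P N \<le> P (N - Suc j) * 1"
          using P_le1[of N] P_pos[of N] by (intro mult_mono) (auto simp: less_imp_le P_pos)
        then have "(P N)\<^sup>2 / P (N - Suc j) \<le> 1" using P_pos by (simp add: power2_eq_square)
        then have "(P N)\<^sup>2 / P (N - Suc j) / P (N + Suc j) \<le> 1 / L"
          using P_ge L P_pos by (intro frac_le) auto
        then have "(P N)\<^sup>2 / (P (N + Suc j) * P (N - Suc j)) \<le> 1 / L" by (simp add: mult.commute)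
        then have "q ^ (Suc j)\<^sup>2 * ((P N)\<^sup>2 / (P (N + Suc j) * P (N - Suc j))) \<le> q ^ j * (1 / L)"
          using q P_pos by (intro mult_mono power_Suc_square_le) (auto simp: less_imp_le)
        then show ?thesis using True q P_pos
          by (simp add: a_def abs_mult power_abs less_imp_le del: power_Suc)
      qed (use q L in \<open>simp add: a_def\<close>)
    qed
    fix j
    have "(\<lambda>N. P (N + Suc j)) \<longlonglongrightarrow> p" using p by (rule LIMSEQ_ignore_initial_segment)
    moreover have "(\<lambda>N. P (N - Suc j)) \<longlonglongrightarrow> p"
      by (rule LIMSEQ_offset[of _ "Suc j"]) (use p in simp)
    ultimately have "(\<lambda>N. (-1) ^ Suc j * q ^ (Suc j)\<^sup>2 * ((P N)\<^sup>2 / (P (N + Suc j) * P (N - Suc j))))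
            \<longlonglongrightarrow> (-1) ^ Suc j * q ^ (Suc j)\<^sup>2 * (p\<^sup>2 / (p * p))"
      using p0 by (intro tendsto_intros p) auto
    then have "(\<lambda>N. (-1) ^ Suc j * q ^ (Suc j)\<^sup>2 * ((P N)\<^sup>2 / (P (N + Suc j) * P (N - Suc j))))
            \<longlonglongrightarrow> (-1) ^ Suc j * q ^ (Suc j)\<^sup>2"
      using p0 by (simp add: power2_eq_square)
    then show "(\<lambda>N. a j N) \<longlonglongrightarrow> (-1) ^ Suc j * q ^ (Suc j)\<^sup>2"
      by (rule Lim_transform_eventually)
         (use eventually_gt_at_top[of j] in eventually_elim, simp add: a_def)
  qed auto
  then have "(\<lambda>N. overp_prod (2 * N) (complex_of_real q) * of_real (1 + 2 * (\<Sum>j. a j N)))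
     \<longlonglongrightarrow> overp_gf (of_real q) * of_real (theta4 q)"
    unfolding theta4_def using q
    by (intro tendsto_intros filterlim_compose[OF overp_prod_tendsto]) 
       (auto intro!: filterlim_subseq simp: strict_mono_def)
  moreover have "overp_prod (2 * N) (complex_of_real q) * of_real (1 + 2 * (\<Sum>j. a j N)) = 1" for N
  proof -
    have "(\<Sum>j. a j N) = (\<Sum>j<N. a j N)" by (intro suminf_finite) (auto simp: a_def)
    also have "\<dots> = (\<Sum>j=1..N. (-1) ^ j * q ^ j\<^sup>2 * ((P N)\<^sup>2 / (P (N + j) * P (N - j))))"
      by (rule sum.reindex_bij_witness[of _ "\<lambda>j. j - 1" "Suc"]) (auto simp: a_def)
    finally have "1 + 2 * (\<Sum>j. a j N) = (P N)\<^sup>2 / P (2 * N) *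
       (P (2 * N) / (P N)\<^sup>2 + 2 * (\<Sum>j=1..N. (-1) ^ j * q ^ j\<^sup>2 *
             (P (2 * N) / (P (N + j) * P (N - j)))))"
      using P_pos[of N] P_pos[of "2 * N"]
      by (simp add: distrib_left sum_distrib_left mult_ac)
    also have "\<dots> = (P N)\<^sup>2 / P (2 * N) * (odd_poch q N)\<^sup>2"
      unfolding P_def odd_poch_square[OF q] ..
    finally have "overp_prod (2 * N) q * (1 + 2 * (\<Sum>j. a j N)) =
        overp_prod (2 * N) q * (odd_poch q N * P N)\<^sup>2 / P (2 * N)"
      by (simp add: power_mult_distrib mult_ac)
    also have "\<dots> = 1"
      using overp_prod_mult_odd_poch[OF q, of N] P_pos[of "2 * N"] unfolding P_def by simp
    finally have "overp_prod (2 * N) q * (1 + 2 * (\<Sum>j. a j N)) = 1" .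
    then have "complex_of_real (overp_prod (2 * N) q * (1 + 2 * (\<Sum>j. a j N))) = 1" by simp
    then show ?thesis by (simp add: overp_prod_def)
  qed
  ultimately show ?thesis
    by (simp add: LIMSEQ_const_iff)
qed

section \<open>The theta transformation\<close>

text \<open>The real part of the characteristic function of the standard normal distribution,
  rescaled by x -> sqrt (2 a) x.\<close>

lemma gaussian_cos_transform:
  fixes a b :: real assumes a: "a > 0"
  shows "has_bochner_integral lborel (\<lambda>x. exp (- a * x\<^sup>2) * cos (b * x)) (sqrt (pi / a) * exp (- b\<^sup>2 / (4 * a)))"
proof -
  interpret real_distribution std_normal_distribution by (rule real_dist_normal_dist)
  define s where "s = sqrt (2 * a)"
  have s: "s > 0" "s\<^sup>2 = 2 * a" using a by (auto simp: s_def)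
  have int: "integrable std_normal_distribution (\<lambda>x. exp (\<i> * complex_of_real (b / s * x)))"
    by (rule integrable_iexp) auto
  have "char std_normal_distribution (b / s) = of_real (exp (- (b / s)\<^sup>2 / 2))"
    by (simp add: char_std_normal_distribution)
  then have "(CLINT x|std_normal_distribution. exp (\<i> * complex_of_real (b / s * x))) = of_real (exp (- (b / s)\<^sup>2 / 2))"
    by (simp add: char_def)
  with int have "has_bochner_integral std_normal_distribution (\<lambda>x. exp (\<i> * complex_of_real (b / s * x)))
      (of_real (exp (- (b / s)\<^sup>2 / 2)))"
    by (simp add: has_bochner_integral_iff)
  from has_bochner_integral_bounded_linear[OF bounded_linear_Re this]
  have "has_bochner_integral std_normal_distribution (\<lambda>x. cos (b / s * x)) (exp (- (b / s)\<^sup>2 / 2))"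
    by (simp add: Re_exp)
  then have "has_bochner_integral lborel (\<lambda>x. std_normal_density x *\<^sub>R cos (b / s * x)) (exp (- (b / s)\<^sup>2 / 2))"
    by (simp add: has_bochner_integral_iff integrable_density integral_density)
  then have "has_bochner_integral lborel (\<lambda>x. std_normal_density (0 + s * x) *\<^sub>R cos (b / s * (0 + s * x)))
       (exp (- (b / s)\<^sup>2 / 2) /\<^sub>R \<bar>s\<bar>)"
    using s by (subst (asm) lborel_has_bochner_integral_real_affine_iff[of s _ _ 0]) auto
  then have "has_bochner_integral lborel (\<lambda>x. sqrt (2 * pi) * (std_normal_density (0 + s * x) *\<^sub>R cos (b / s * (0 + s * x))))
       (sqrt (2 * pi) * (exp (- (b / s)\<^sup>2 / 2) /\<^sub>R \<bar>s\<bar>))"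
    by (rule has_bochner_integral_mult_right)
  also have "(\<lambda>x. sqrt (2 * pi) * (std_normal_density (0 + s * x) *\<^sub>R cos (b / s * (0 + s * x)))) =
             (\<lambda>x. exp (- a * x\<^sup>2) * cos (b * x))"
    using s by (auto simp: std_normal_density_def power_mult_distrib)
  also have "sqrt (2 * pi) * (exp (- (b / s)\<^sup>2 / 2) /\<^sub>R \<bar>s\<bar>) = sqrt (pi / a) * exp (- b\<^sup>2 / (4 * a))"
  proof -
    have "sqrt (2 * pi) / \<bar>s\<bar> = sqrt (pi / a)"
      using a by (simp add: s_def real_sqrt_mult real_sqrt_divide)
    moreover have "- (b / s)\<^sup>2 / 2 = - b\<^sup>2 / (4 * a)" using s by (simp add: power_divide)
    moreover have "sqrt (2 * pi) * (e /\<^sub>R \<bar>s\<bar>) = sqrt (2 * pi) / \<bar>s\<bar> * e" for e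
      by (simp add: divide_inverse)
    ultimately show ?thesis by (simp only:)
  qed
  finally show ?thesis .
qed

lemma integral_symmetric_tendsto:
  fixes f :: "real \<Rightarrow> real"
  assumes f: "has_bochner_integral lborel f I"
  shows "(\<lambda>M. integral {- real M..real M} f) \<longlonglongrightarrow> I"
proof -
  have int: "integrable lborel f" using f by (simp add: has_bochner_integral_iff)
  have "(\<lambda>M. LINT x|lborel. indicator {- real M..real M} x *\<^sub>R f x) \<longlonglongrightarrow> (LINT x|lborel. f x)"
  proof (rule integral_dominated_convergence[where w = "\<lambda>x. norm (f x)"])
    show "AE x in lborel. (\<lambda>M. indicator {- real M..real M} x *\<^sub>R f x) \<longlonglongrightarrow> f x"
    proof (intro AE_I2 tendsto_eventually)
      fix x :: real
      show "\<forall>\<^sub>F M in sequentially. indicator {- real M..real M} x *\<^sub>R f x = f x"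
        by (rule eventually_mono[OF eventually_ge_at_top[of "nat \<lceil>\<bar>x\<bar>\<rceil>"]])
           (auto simp: indicator_def nat_le_iff ceiling_le_iff abs_le_iff)
    qed
    show "f \<in> borel_measurable lborel" using int by auto
    then show "(\<lambda>x. indicator {- real M..real M} x *\<^sub>R f x) \<in> borel_measurable lborel" for M
      by measurable
    show "integrable lborel (\<lambda>x. norm (f x))" using int by (rule integrable_norm)
    show "AE x in lborel. norm (indicator {- real M..real M} x *\<^sub>R f x) \<le> norm (f x)" for M
      by (rule AE_I2) (simp add: indicator_def)
  qed
  moreover have "(LINT x|lborel. indicator {- real M..real M} x *\<^sub>R f x) = integral {- real M..real M} f" for M
  proof -
    have "set_integrable lborel {- real M..real M} f"
      unfolding set_integrable_def by (rule integrable_mult_indicator[OF _ int]) simp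
    from set_borel_integral_eq_integral(2)[OF this] show ?thesis by (simp add: set_lebesgue_integral_def)
  qed
  ultimately show ?thesis using f by (simp add: has_bochner_integral_iff)
qed

section \<open>Cosine series on the unit interval\<close>

lemma uniform_series_times_integral:
  fixes f :: "nat \<Rightarrow> real \<Rightarrow> real"
  assumes cont: "\<And>m. continuous_on {0..1} (f m)"
    and bound: "\<And>m x. x \<in> {0..1} \<Longrightarrow> \<bar>f m x\<bar> \<le> B m" and B: "summable B"
    and g: "continuous_on {0..1} g" "\<And>x. x \<in> {0..1} \<Longrightarrow> \<bar>g x\<bar> \<le> 1"
  shows "(\<lambda>m. integral {0..1} (\<lambda>x. f m x * g x)) sums integral {0..1} (\<lambda>x. (\<Sum>m. f m x) * g x)"
    and "continuous_on {0..1} (\<lambda>x. \<Sum>m. f m x)"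
proof -
  have ul: "uniform_limit {0..1} (\<lambda>n x. \<Sum>m<n. f m x) (\<lambda>x. \<Sum>m. f m x) sequentially"
    by (rule Weierstrass_m_test[OF _ B]) (use bound in auto)
  then show "continuous_on {0..1} (\<lambda>x. \<Sum>m. f m x)"
    by (rule uniform_limit_theorem[rotated])
       (auto intro!: always_eventually continuous_on_sum cont)
  have fg: "continuous_on {0..1} (\<lambda>x. f m x * g x)" for m
    by (intro continuous_intros cont g)
  have "uniform_limit {0..1} (\<lambda>n x. \<Sum>m<n. f m x * g x) (\<lambda>x. \<Sum>m. f m x * g x) sequentially"
  proof (rule Weierstrass_m_test[OF _ B])
    fix n x assume x: "x \<in> {0..1::real}"
    have "\<bar>f n x\<bar> * \<bar>g x\<bar> \<le> \<bar>f n x\<bar> * 1" by (rule mult_left_mono) (use g(2)[OF x] in auto)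
    with bound[OF x, of n] show "norm (f n x * g x) \<le> B n" by (simp add: abs_mult)
  qed
  then obtain I J where IJ:
    "\<And>n. ((\<lambda>x. \<Sum>m<n. f m x * g x) has_integral I n) {0..1}"
    "((\<lambda>x. \<Sum>m. f m x * g x) has_integral J) {0..1}" "I \<longlonglongrightarrow> J"
    by (rule uniform_limit_integral) (auto intro!: continuous_on_sum fg)
  have "I = (\<lambda>n. \<Sum>m<n. integral {0..1} (\<lambda>x. f m x * g x))"
    by (rule ext, rule has_integral_unique[OF IJ(1) has_integral_sum])
       (auto intro!: integrable_integral integrable_continuous_real fg)
  moreover have "J = integral {0..1} (\<lambda>x. (\<Sum>m. f m x) * g x)"
  proof -
    have "summable (\<lambda>m. f m x)" if "x \<in> {0..1}" for x
      using bound[OF that] by (intro summable_comparison_test[OF _ B]) auto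
    then have "integral {0..1} (\<lambda>x. \<Sum>m. f m x * g x) = integral {0..1} (\<lambda>x. (\<Sum>m. f m x) * g x)"
      by (intro integral_cong) (simp add: suminf_mult2)
    with integral_unique[OF IJ(2)] show ?thesis by simp
  qed
  ultimately show "(\<lambda>m. integral {0..1} (\<lambda>x. f m x * g x)) sums integral {0..1} (\<lambda>x. (\<Sum>m. f m x) * g x)"
    using IJ(3) by (simp add: sums_def)
qed

text \<open>The symmetry makes \<open>H\<close> a continuous function of cos (2 pi x), hence
  uniformly close to polynomials in it. \<open>H\<close> is orthogonal to all of these, so the
  integral of H^2 is at most e times that of |H| for every e > 0.\<close>

lemma cos_coefficients_eq_0_imp_eq_0:
  fixes H :: "real \<Rightarrow> real"
  assumes cont: "continuous_on {0..1} H" and sym: "\<And>x. H (1 - x) = H x"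
    and coeff: "\<And>k::nat. integral {0..1} (\<lambda>x. H x * cos (2 * pi * real k * x)) = 0"
    and x: "x \<in> {0..1}"
  shows "H x = 0"
proof -
  \<comment> \<open>The product-to-sum formula trades one power of the cosine for the frequencies k
    - 1 and k + 1; integer \<open>k\<close> lets the induction pass below 0.\<close>
  have pow: "integral {0..1} (\<lambda>x. H x * (cos (2 * pi * x) ^ j * cos (2 * pi * of_int k * x))) = 0" for j and k :: int
  proof (induction j arbitrary: k)
    case 0
    have "cos (2 * pi * of_int k * x) = cos (2 * pi * real (nat \<bar>k\<bar>) * x)" for x :: real
    proof (cases "k \<ge> 0")
      case False
      then have "2 * pi * real (nat \<bar>k\<bar>) * x = - (2 * pi * of_int k * x)" by simp
      then show ?thesis by (simp only: cos_minus)
    qed simp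
    then show ?case using coeff[of "nat \<bar>k\<bar>"] by simp
  next
    case (Suc j)
    let ?f = "\<lambda>k x. H x * (cos (2 * pi * x) ^ j * cos (2 * pi * of_int k * x))"
    have "H x * (cos (2 * pi * x) ^ Suc j * cos (2 * pi * of_int k * x)) =
          1/2 * ?f (k + 1) x + 1/2 * ?f (k - 1) x" for x
    proof -
      have "cos (2 * pi * x) * cos (2 * pi * of_int k * x) =
         (cos (2 * pi * of_int (k - 1) * x) + cos (2 * pi * of_int (k + 1) * x)) / 2"
        using cos_times_cos[of "2 * pi * of_int k * x" "2 * pi * x"]
        by (simp add: algebra_simps)
      moreover have "H x * (cos (2 * pi * x) ^ Suc j * cos (2 * pi * of_int k * x)) =
          H x * cos (2 * pi * x) ^ j * (cos (2 * pi * x) * cos (2 * pi * of_int k * x))" by simp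
      ultimately show ?thesis by (simp only:) (simp add: distrib_left)
    qed
    moreover have "integral {0..1} (\<lambda>x. 1/2 * ?f (k + 1) x + 1/2 * ?f (k - 1) x) =
        integral {0..1} (\<lambda>x. 1/2 * ?f (k + 1) x) + integral {0..1} (\<lambda>x. 1/2 * ?f (k - 1) x)"
      by (intro integral_add integrable_continuous_real continuous_intros cont)
    ultimately show ?case by (simp only: integral_mult_right Suc)
  qed
  have H2: "continuous_on {0..1} (\<lambda>x. (H x)\<^sup>2)" by (intro continuous_intros cont)
  \<comment> \<open>\<open>H\<close> in the variable y = cos (2 pi x); the arccosine returns only
    points of [0, 1/2], and the symmetry supplies the other half.\<close>
  define h where "h = (\<lambda>y. H (arccos y / (2 * pi)))"
  have "continuous_on {-1..1} h"
    unfolding h_def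
  proof (rule continuous_on_compose2[OF cont])
    have "arccos y \<le> 2 * pi" if "-1 \<le> y" "y \<le> 1" for y
      using arccos_ubound[OF that] pi_ge_zero by linarith
    then show "(\<lambda>y. arccos y / (2 * pi)) ` {-1..1} \<subseteq> {0..1}"
      by (auto simp: arccos_lbound)
  qed (auto intro!: continuous_intros)
  have Hh: "H x = h (cos (2 * pi * x))" if x: "x \<in> {0..1}" for x
  proof (cases "x \<le> 1/2")
    case True
    then have "arccos (cos (2 * pi * x)) = 2 * pi * x" using x by (intro arccos_cos) auto
    then show ?thesis by (simp add: h_def)
  next
    case False
    have "cos (2 * pi * x) = cos (2 * pi * (1 - x))"
      by (simp add: right_diff_distrib cos_diff)
    moreover have "arccos (cos (2 * pi * (1 - x))) = 2 * pi * (1 - x)" 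
      using x False by (intro arccos_cos) auto
    ultimately show ?thesis using sym[of x] by (simp add: h_def)
  qed
  have "integral {0..1} (\<lambda>x. (H x)\<^sup>2) \<le> e * integral {0..1} (\<lambda>x. \<bar>H x\<bar>)" if e: "e > 0" for e
  proof -
    obtain g where g: "real_polynomial_function g" "\<And>y. y \<in> {-1..1} \<Longrightarrow> \<bar>h y - g y\<bar> < e"
      using Stone_Weierstrass_real_polynomial_function[OF _ \<open>continuous_on {-1..1} h\<close> e] by auto
    obtain a n where gs: "g = (\<lambda>y. \<Sum>i\<le>n. a i * y ^ i)"
      using g(1) unfolding real_polynomial_function_iff_sum by auto
    have "integral {0..1} (\<lambda>x. H x * g (cos (2 * pi * x))) =
          (\<Sum>i\<le>n. integral {0..1} (\<lambda>x. a i * (H x * (cos (2 * pi * x) ^ i * cos (2 * pi * of_int 0 * x)))))"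
      unfolding gs
      by (subst integral_sum[symmetric])
         (auto intro!: integrable_continuous_real continuous_intros cont integral_cong
           simp: sum_distrib_left mult_ac)
    also have "\<dots> = 0" by (simp only: integral_mult_right pow) simp
    finally have 0: "integral {0..1} (\<lambda>x. H x * g (cos (2 * pi * x))) = 0" .
    have gc: "continuous_on {0..1} (\<lambda>x. g (cos (2 * pi * x)))"
      unfolding gs by (intro continuous_intros)
    have "integral {0..1} (\<lambda>x. (H x)\<^sup>2) =
          integral {0..1} (\<lambda>x. (H x)\<^sup>2 - H x * g (cos (2 * pi * x)))"
      by (subst integral_diff) (auto intro!: integrable_continuous_real continuous_intros cont gc simp: 0)
    also have "\<dots> \<le> integral {0..1} (\<lambda>x. e * \<bar>H x\<bar>)"
    proof (rule integral_le)
      fix x :: real assume x: "x \<in> {0..1}"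
      have "\<bar>H x\<bar> * \<bar>h (cos (2 * pi * x)) - g (cos (2 * pi * x))\<bar> \<le> \<bar>H x\<bar> * e"
        using g(2)[of "cos (2 * pi * x)"] by (intro mult_left_mono) auto
      moreover have "(H x)\<^sup>2 - H x * g (cos (2 * pi * x)) = H x * (h (cos (2 * pi * x)) - g (cos (2 * pi * x)))"
        using Hh[OF x] by (simp add: power2_eq_square right_diff_distrib)
      ultimately show "(H x)\<^sup>2 - H x * g (cos (2 * pi * x)) \<le> e * \<bar>H x\<bar>"
        using abs_ge_self[of "H x * (h (cos (2 * pi * x)) - g (cos (2 * pi * x)))"]
        unfolding abs_mult mult.commute[of e] by linarith
    qed (auto intro!: integrable_continuous_real continuous_intros cont gc)
    also have "\<dots> = e * integral {0..1} (\<lambda>x. \<bar>H x\<bar>)" by (rule integral_mult_right)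
    finally show ?thesis .
  qed
  note small = this
  define A where "A = integral {0..1} (\<lambda>x. \<bar>H x\<bar>)"
  have A: "A \<ge> 0" unfolding A_def
    by (intro integral_nonneg integrable_continuous_real continuous_intros cont) auto
  have "integral {0..1} (\<lambda>x. (H x)\<^sup>2) \<le> 0"
  proof (rule field_le_epsilon)
    fix e :: real assume e: "e > 0"
    have "integral {0..1} (\<lambda>x. (H x)\<^sup>2) \<le> e / (A + 1) * A" 
      using small[of "e / (A + 1)"] e A unfolding A_def by simp
    also have "\<dots> \<le> e" using e A by (simp add: field_simps)
    finally show "integral {0..1} (\<lambda>x. (H x)\<^sup>2) \<le> 0 + e" by simp
  qed
  moreover have "integral {0..1} (\<lambda>x. (H x)\<^sup>2) \<ge> 0"
    by (intro integral_nonneg integrable_continuous_real H2) auto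
  ultimately have "integral {0..1} (\<lambda>x. (H x)\<^sup>2) = 0" by simp
  then have "((\<lambda>x. (H x)\<^sup>2) has_integral 0) (cbox 0 1)"
    using integrable_integral[OF integrable_continuous_real[OF H2]] by simp
  then have "(H x)\<^sup>2 = 0"
    using has_integral_0_cbox_imp_0[of 0 1 "\<lambda>x. (H x)\<^sup>2" x] H2 x by simp
  then show ?thesis by simp
qed

lemma integral_cos_int_period:
  assumes "j \<noteq> (0::int)"
  shows "((\<lambda>x. cos (2 * pi * of_int j * x)) has_integral 0) {0..1::real}"
proof -
  have "((\<lambda>x. cos (2 * pi * of_int j * x)) has_integral
      (sin (2 * pi * of_int j * 1) / (2 * pi * of_int j) - sin (2 * pi * of_int j * 0) / (2 * pi * of_int j))) {0..1::real}"
    using assms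
    by (intro fundamental_theorem_of_calculus)
       (auto intro!: derivative_eq_intros simp flip: has_real_derivative_iff_has_vector_derivative)
  moreover have "sin (2 * pi * of_int j * 1) = (0::real)"
    using sin_int_2pin[of j] by (simp add: mult_ac)
  ultimately show ?thesis by simp
qed

lemma integral_cos_times_cos_period:
  assumes "n > 0"
  shows "integral {0..1} (\<lambda>x. cos (2 * pi * real n * x) * cos (2 * pi * real k * x)) = (if n = k then 1/2 else 0)"
proof -
  let ?c = "\<lambda>j x. cos (2 * pi * of_int j * x :: real)"
  have eq: "cos (2 * pi * real n * x) * cos (2 * pi * real k * x) =
        1/2 * ?c (int n - int k) x + 1/2 * ?c (int n + int k) x" for x
    using cos_times_cos[of "2 * pi * real n * x" "2 * pi * real k * x"] by (simp add: algebra_simps)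
  have 1: "(?c (int n + int k) has_integral 0) {0..1}"
    by (rule integral_cos_int_period) (use assms in auto)
  have 2: "(?c (int n - int k) has_integral (if n = k then 1 else 0)) {0..1}"
  proof (cases "n = k")
    case True
    have "((\<lambda>_::real. 1::real) has_integral 1) {0..1}"
      using has_integral_const_real[of "1::real" 0 1] by simp
    then show ?thesis using True by simp
  next
    case False
    then show ?thesis using integral_cos_int_period[of "int n - int k"] by simp
  qed
  have "((\<lambda>x. 1/2 * ?c (int n - int k) x + 1/2 * ?c (int n + int k) x) has_integral
          (1/2 * (if n = k then 1 else 0) + 1/2 * 0)) {0..1}"
    by (intro has_integral_add has_integral_mult_right 1 2)
  then show ?thesis unfolding eq by (simp add: integral_unique split: if_splits)
qed

text \<open>2 * Q * \<open>theta2_series Q\<close> is Jacobi's theta_2 at the nome Q^4, since 4 m (m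
  + 1) + 1 = (2 m + 1)^2. Splitting off Q leaves a series with constant term 1 and no fractional
  powers.\<close>

definition theta2_series :: "'a \<Rightarrow> 'a::{banach,real_normed_field}" where
  "theta2_series Q = (\<Sum>m. Q ^ (4 * m * (m + 1)))"

text \<open>Poisson summation at x = 1/2. The periodised Gaussian \<open>F\<close> and the cosine
  series 1 + 2 * \<open>G\<close> are shown to have the same cosine coefficients; at 1/2 the cosines
  become the signs of \<open>theta4\<close> and the shifts become half-integers.\<close>

theorem theta4_transformation_real:
  fixes t :: real assumes t: "t > 0"
  shows "theta4 (exp (- t)) =
           2 * sqrt (pi / t) * exp (- pi\<^sup>2 / (4 * t)) * theta2_series (exp (- pi\<^sup>2 / (4 * t)))"
proof -
  \<comment> \<open>\<open>a\<close> and \<open>c\<close> are chosen so that the Gaussian c exp (- a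
    x^2) has cosine transform exp (- t k^2) at the frequency 2 pi k.\<close>
  define a where "a = pi\<^sup>2 / t"
  define c where "c = sqrt (pi / t)"
  define f where "f = (\<lambda>x::real. exp (- a * x\<^sup>2))"
  \<comment> \<open>Pairing the shifts m and -(m + 1) meets every integer once, and for x in [0, 1]
    both arguments have absolute value at least m, which gives a geometric majorant.\<close>
  define F where "F = (\<lambda>x. \<Sum>m. c * (f (x + real m) + f (x - real (Suc m))))"
  define G where "G = (\<lambda>x. \<Sum>n. exp (- t) ^ (Suc n)\<^sup>2 * cos (2 * pi * real (Suc n) * x))"
  define cs where "cs = (\<lambda>(k::nat) x. cos (2 * pi * real k * x))"
  have a: "a > 0" using t by (simp add: a_def)
  have c: "c > 0" using t by (simp add: c_def)
  have cont_f: "continuous_on S (\<lambda>x. f (g x))" if "continuous_on S g" for S :: "real set" and g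
    unfolding f_def by (intro continuous_intros that)
  have cs: "continuous_on S (cs k)" "\<bar>cs k x\<bar> \<le> 1" for S k x
    unfolding cs_def by (auto intro!: continuous_intros)
  have f_bound: "f y \<le> exp (- a) ^ m" if "\<bar>y\<bar> \<ge> real m" for m y
  proof -
    have "real m \<le> (real m)\<^sup>2" by (cases m) (auto simp: power2_eq_square)
    also have "\<dots> \<le> y\<^sup>2" using that by (simp add: abs_le_square_iff[symmetric])
    finally have "a * real m \<le> a * y\<^sup>2" using a by (intro mult_left_mono) auto
    then show ?thesis by (simp add: f_def exp_of_nat_mult[symmetric] mult.commute)
  qed
  have F_bound: "\<bar>c * (f (x + real m) + f (x - real (Suc m)))\<bar> \<le> 2 * c * exp (- a) ^ m"
    if x: "x \<in> {0..1}" for m x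
  proof -
    have "f (x + real m) + f (x - real (Suc m)) \<le> 2 * exp (- a) ^ m"
      using f_bound[of m "x + real m"] f_bound[of m "x - real (Suc m)"] x by simp
    then have "c * (f (x + real m) + f (x - real (Suc m))) \<le> c * (2 * exp (- a) ^ m)"
      using c by (intro mult_left_mono) auto
    moreover have "f y \<ge> 0" for y by (simp add: f_def)
    ultimately show ?thesis using c by (simp add: abs_mult mult_ac)
  qed
  have F_sum: "summable (\<lambda>m. 2 * c * exp (- a) ^ m)"
    using a by (intro summable_mult summable_geometric) auto
  have G_bound: "\<bar>exp (- t) ^ (Suc n)\<^sup>2 * cos (2 * pi * real (Suc n) * x)\<bar> \<le> exp (- t) ^ n" for n x
  proof -
    have "\<bar>exp (- t) ^ (Suc n)\<^sup>2 * cos (2 * pi * real (Suc n) * x)\<bar> \<le> exp (- t) ^ (Suc n)\<^sup>2 * 1"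
      unfolding abs_mult by (intro mult_mono) auto
    also have "\<dots> \<le> exp (- t) ^ n" using t power_Suc_square_le[of "exp (- t)" n] by simp
    finally show ?thesis .
  qed
  have G_sum: "summable (\<lambda>m. exp (- t) ^ m)"
    using t by (intro summable_geometric) auto
  have cont_Fm: "continuous_on {0..1} (\<lambda>x. c * (f (x + real m) + f (x - real (Suc m))))" for m
    by (intro continuous_intros cont_f)
  have cont_Gm: "continuous_on {0..1} (\<lambda>x. exp (- t) ^ (Suc n)\<^sup>2 * cos (2 * pi * real (Suc n) * x))" for n
    by (intro continuous_intros)
  have F_int: "integral {0..1} (\<lambda>x. F x * cs k x) = exp (- t * (real k)\<^sup>2)" for k
  proof -
    define g where "g = (\<lambda>x. f x * cs k x)"
    have g_int: "g integrable_on {u..v}" for u v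
      unfolding g_def by (intro integrable_continuous_real continuous_intros cs cont_f)
    have shift: "integral {0..1} (\<lambda>x. f (x + d) * cs k x) = integral {d..d + 1} g"
      if d: "d \<in> \<int>" for d
    proof -
      obtain i where i: "d = of_int i" using d by (rule Ints_cases)
      have "cs k (x + d) = cs k x" for x
      proof -
        have "2 * pi * real k * (x + d) = 2 * pi * real k * x + 2 * pi * of_int (i * int k)"
          by (simp add: i algebra_simps)
        then show ?thesis by (simp only: cs_def cos_add cos_int_2pin sin_int_2pin; simp)
      qed
      then have "integral {0..1} (\<lambda>x. f (x + d) * cs k x) = integral {0..1} (g \<circ> (\<lambda>x. x + d))"
        by (simp add: g_def o_def)
      also have "\<dots> = integral {0 + d..1 + d} g"
        unfolding g_def by (intro integral_shift continuous_intros cs cont_f)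
      finally show ?thesis by (simp add: add.commute)
    qed
    have piece: "integral {0..1} (\<lambda>x. c * (f (x + real m) + f (x - real (Suc m))) * cs k x) =
          c * (integral {real m..real m + 1} g + integral {- real (Suc m)..- real (Suc m) + 1} g)" for m
    proof -
      have "integral {0..1} (\<lambda>x. c * (f (x + real m) + f (x - real (Suc m))) * cs k x) =
            integral {0..1} (\<lambda>x. c * (f (x + real m) * cs k x + f (x + (- real (Suc m))) * cs k x))"
        by (intro integral_cong) (simp add: algebra_simps)
      also have "\<dots> = c * (integral {0..1} (\<lambda>x. f (x + real m) * cs k x) +
                          integral {0..1} (\<lambda>x. f (x + (- real (Suc m))) * cs k x))"
        by (subst integral_mult_right, subst integral_add)
           (auto intro!: integrable_continuous_real continuous_intros cs cont_f)
      finally show ?thesis by (simp only: shift Ints_of_nat Ints_minus)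
    qed
    have "(\<lambda>m. integral {0..1} (\<lambda>x. c * (f (x + real m) + f (x - real (Suc m))) * cs k x))
             sums integral {0..1} (\<lambda>x. F x * cs k x)"
      unfolding F_def
      by (rule uniform_series_times_integral(1)[OF cont_Fm F_bound F_sum]) (use cs in auto)
    \<comment> \<open>The translated unit intervals fill [-M, M], so the partial sums become
      symmetric integrals of the unfolded Gaussian.\<close>
    moreover have "(\<Sum>m<M. integral {0..1} (\<lambda>x. c * (f (x + real m) + f (x - real (Suc m))) * cs k x)) =
          c * integral {- real M..real M} g" for M
    proof (induction M)
      case (Suc M)
      have "integral {- real (Suc M)..real (Suc M)} g =
            integral {- real (Suc M)..- real M} g + integral {- real M..real (Suc M)} g"
        by (rule Henstock_Kurzweil_Integration.integral_combine[symmetric]) (auto simp: g_int)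
      also have "integral {- real M..real (Suc M)} g =
            integral {- real M..real M} g + integral {real M..real (Suc M)} g"
        by (rule Henstock_Kurzweil_Integration.integral_combine[symmetric]) (auto simp: g_int)
      finally show ?case using Suc unfolding sum.lessThan_Suc piece
        by (simp add: algebra_simps)
    qed simp
    ultimately have "(\<lambda>M. c * integral {- real M..real M} g) \<longlonglongrightarrow> integral {0..1} (\<lambda>x. F x * cs k x)"
      by (simp add: sums_def)
    moreover have "(\<lambda>M. c * integral {- real M..real M} g) \<longlonglongrightarrow>
        c * (sqrt (pi / a) * exp (- (2 * pi * real k)\<^sup>2 / (4 * a)))"
      using gaussian_cos_transform[OF a, of "2 * pi * real k"]
      unfolding g_def f_def cs_def by (intro tendsto_mult_left integral_symmetric_tendsto)
    ultimately have "integral {0..1} (\<lambda>x. F x * cs k x) =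
        c * sqrt (pi / a) * exp (- (2 * pi * real k)\<^sup>2 / (4 * a))"
      using LIMSEQ_unique by (fastforce simp: mult.assoc)
    also have "c * sqrt (pi / a) = 1"
      using t by (simp add: c_def a_def real_sqrt_mult[symmetric] power2_eq_square)
    also have "- (2 * pi * real k)\<^sup>2 / (4 * a) = - t * (real k)\<^sup>2"
      using t by (simp add: a_def power_mult_distrib)
    finally show ?thesis by simp
  qed
  have G_int: "integral {0..1} (\<lambda>x. (1 + 2 * G x) * cs k x) = exp (- t * (real k)\<^sup>2)" for k
  proof -
    have contG: "continuous_on {0..1} G"
      unfolding G_def
      by (rule uniform_series_times_integral(2)[OF cont_Gm G_bound G_sum, of "\<lambda>_. 1"]) auto
    have 0: "integral {0..1} (cs k) = (if k = 0 then 1 else 0)"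
      using integral_unique[OF integral_cos_int_period[of "int k"]] by (auto simp: cs_def)
    have s1: "(\<lambda>n. integral {0..1} (\<lambda>x. exp (- t) ^ (Suc n)\<^sup>2 * cos (2 * pi * real (Suc n) * x) * cs k x))
             sums integral {0..1} (\<lambda>x. G x * cs k x)"
      unfolding G_def
      by (rule uniform_series_times_integral(1)[OF cont_Gm G_bound G_sum]) (use cs in auto)
    \<comment> \<open>\<open>G\<close> starts at frequency 1, so frequency \<open>k\<close> has
      index \<open>k - 1\<close>; the guard \<open>k > 0\<close> protects against truncated
      subtraction at k = 0.\<close>
    have s2: "integral {0..1} (\<lambda>x. exp (- t) ^ (Suc n)\<^sup>2 * cos (2 * pi * real (Suc n) * x) * cs k x)
        = (if n = k - 1 \<and> k > 0 then exp (- t) ^ k\<^sup>2 / 2 else 0)" for n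
      unfolding cs_def mult.assoc[of "exp (- t) ^ _"]
      by (subst integral_mult_right, subst integral_cos_times_cos_period) auto
    have s3: "(\<lambda>n. if n = k - 1 \<and> k > 0 then exp (- t) ^ k\<^sup>2 / 2 else 0) sums
                   (if k > 0 then exp (- t) ^ k\<^sup>2 / 2 else 0)"
      using sums_If_finite_set[of "{k - 1}" "\<lambda>_. if k > 0 then exp (- t) ^ k\<^sup>2 / 2 else 0"]
      by (auto simp: if_distrib cong: if_cong)
    have "integral {0..1} (\<lambda>x. G x * cs k x) = (if k > 0 then exp (- t) ^ k\<^sup>2 / 2 else 0)"
      by (rule sums_unique2[OF s1[unfolded s2] s3])
    moreover have "integral {0..1} (\<lambda>x. (1 + 2 * G x) * cs k x) =
          integral {0..1} (\<lambda>x. cs k x + 2 * (G x * cs k x))"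
      by (intro integral_cong) (simp add: algebra_simps)
    moreover have "\<dots> = integral {0..1} (cs k) + 2 * integral {0..1} (\<lambda>x. G x * cs k x)"
      by (subst integral_add, intro integrable_continuous_real cs,
          intro integrable_continuous_real continuous_intros cs contG, simp)
    ultimately show ?thesis using 0
      by (simp add: exp_of_nat_mult[symmetric] mult.commute)
  qed
  define H where "H = (\<lambda>x. F x - (1 + 2 * G x))"
  have contF: "continuous_on {0..1} F"
    unfolding F_def
    by (rule uniform_series_times_integral(2)[OF cont_Fm F_bound F_sum, of "\<lambda>_. 1"]) auto
  have contG: "continuous_on {0..1} G"
    unfolding G_def
    by (rule uniform_series_times_integral(2)[OF cont_Gm G_bound G_sum, of "\<lambda>_. 1"]) auto
  have "H (1/2) = 0"
  proof (rule cos_coefficients_eq_0_imp_eq_0[of H])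
    show "continuous_on {0..1} H" unfolding H_def by (intro continuous_intros contF contG)
    fix k :: nat
    have "integral {0..1} (\<lambda>x. H x * cs k x) =
          integral {0..1} (\<lambda>x. F x * cs k x - (1 + 2 * G x) * cs k x)"
      unfolding H_def by (simp only: left_diff_distrib)
    also have "\<dots> = 0"
      by (subst integral_diff)
         (auto intro!: integrable_continuous_real continuous_intros contF contG cs simp: F_int G_int)
    finally show "integral {0..1} (\<lambda>x. H x * cos (2 * pi * real k * x)) = 0" unfolding cs_def .
  next
    fix x :: real
    have f_even: "f (- y) = f y" for y by (simp add: f_def)
    have "f (1 - x + real m) + f (1 - x - real (Suc m)) = f (x + real m) + f (x - real (Suc m))" for m
      using f_even[of "1 - x + real m"] f_even[of "1 - x - real (Suc m)"] by (simp add: algebra_simps)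
    then have "F (1 - x) = F x" unfolding F_def by (simp only:)
    moreover have "cos (2 * pi * real n * (1 - x)) = cos (2 * pi * real n * x)" for n
    proof -
      have "2 * pi * real n * (1 - x) = 2 * pi * of_int (int n) - 2 * pi * real n * x"
        by (simp add: algebra_simps)
      then show ?thesis by (simp only: cos_diff cos_int_2pin sin_int_2pin; simp)
    qed
    then have "G (1 - x) = G x" unfolding G_def by (simp only:)
    ultimately show "H (1 - x) = H x" by (simp add: H_def)
  qed auto
  then have FG: "F (1/2) = 1 + 2 * G (1/2)" by (simp add: H_def)
  have "cos (2 * pi * real n * (1/2)) = (-1) ^ n" for n :: nat
    using cos_npi[of n] by (simp add: mult_ac)
  then have "G (1/2) = (\<Sum>n. (-1) ^ Suc n * exp (- t) ^ (Suc n)\<^sup>2)"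
    unfolding G_def by (simp only: mult.commute)
  then have 1: "1 + 2 * G (1/2) = theta4 (exp (- t))" by (simp add: theta4_def)
  define Q where "Q = exp (- pi\<^sup>2 / (4 * t))"
  \<comment> \<open>Here a (m + 1/2)^2 = pi^2 / (4 t) * (2 m + 1)^2, and the two members of each
    pair coincide because \<open>f\<close> is even.\<close>
  have "c * (f (1/2 + real m) + f (1/2 - real (Suc m))) = 2 * c * Q * Q ^ (4 * m * (m + 1))" for m
  proof -
    have "f (1/2 - real (Suc m)) = f (1/2 + real m)"
      by (simp add: f_def power2_eq_square algebra_simps)
    moreover have "f (1/2 + real m) = Q ^ Suc (4 * m * (m + 1))"
      unfolding f_def Q_def exp_of_nat_mult[symmetric]
      by (simp add: a_def power2_eq_square field_simps)
    ultimately show ?thesis by simp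
  qed
  then have "F (1/2) = (\<Sum>m. 2 * c * Q * Q ^ (4 * m * (m + 1)))" unfolding F_def by (simp only:)
  also have "\<dots> = 2 * c * Q * theta2_series Q"
    unfolding theta2_series_def
  proof (rule suminf_mult)
    have Q: "0 \<le> Q" "Q < 1" using t by (auto simp: Q_def)
    show "summable (\<lambda>m. Q ^ (4 * m * (m + 1)))"
      by (rule summable_comparison_test[OF _ summable_geometric[of Q]])
         (use Q in \<open>auto intro!: exI[of _ 0] power_decreasing\<close>)
  qed
  finally show ?thesis using FG 1 by (simp add: c_def Q_def)
qed

section \<open>The generating function near and away from the point 1\<close>

lemma overp_gf_holomorphic: "overp_gf holomorphic_on ball 0 1"
  by (rule power_series_holomorphic[where a = "\<lambda>k. of_nat (overp k)"])
     (use overp_gf_sums in auto)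

lemma theta2_series_sums:
  fixes Q :: "'a::{banach,real_normed_field}"
  assumes "norm Q < 1"
  shows "(\<lambda>m. Q ^ (4 * m * (m + 1))) sums theta2_series Q"
  unfolding theta2_series_def
proof (rule summable_sums, rule summable_comparison_test[OF _ summable_geometric[of "norm Q"]])
  show "\<exists>N. \<forall>m\<ge>N. norm (Q ^ (4 * m * (m + 1))) \<le> norm Q ^ m"
    using assms by (auto intro!: exI[of _ 0] power_decreasing simp: norm_power)
qed (use assms in auto)

lemma theta2_series_holomorphic: "theta2_series holomorphic_on ball (0::complex) 1"
proof (rule power_series_holomorphic)
  fix Q :: complex assume Q: "Q \<in> ball 0 1"
  let ?g = "\<lambda>m::nat. 4 * m * (m + 1)"
  have mono: "strict_mono ?g" by (rule strict_monoI_Suc, rule mult_strict_mono) auto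
  have "(\<lambda>m. (if ?g m \<in> range ?g then 1 else 0) * (Q - 0) ^ ?g m) sums theta2_series Q"
    using theta2_series_sums[of Q] Q by simp
  then show "(\<lambda>n. (if n \<in> range ?g then 1 else 0) * (Q - 0) ^ n) sums theta2_series Q"
    by (subst (asm) sums_mono_reindex[OF mono]) auto
qed

lemma norm_theta2_series_minus_1_le:
  fixes Q :: "'a::{banach,real_normed_field}"
  assumes "norm Q \<le> 1 / 4"
  shows "norm (theta2_series Q - 1) \<le> 2 * norm Q"
proof -
  have "(\<lambda>m. Q ^ (4 * Suc m * (Suc m + 1))) sums (theta2_series Q - 1)"
    using theta2_series_sums[of Q] assms
    by (subst sums_Suc_iff[of "\<lambda>m. Q ^ (4 * m * (m + 1))"]) simp
  then have "theta2_series Q - 1 = (\<Sum>m. Q ^ (4 * Suc m * (Suc m + 1)))" by (simp add: sums_iff)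
  also have "norm \<dots> \<le> (\<Sum>m. norm Q * norm Q ^ m)"
  proof (rule norm_suminf_le)
    fix m
    have "norm Q ^ (4 * Suc m * (Suc m + 1)) \<le> norm Q ^ Suc m"
      using assms by (intro power_decreasing) auto
    then show "norm (Q ^ (4 * Suc m * (Suc m + 1))) \<le> norm Q * norm Q ^ m"
      unfolding norm_power by simp
  qed (use assms in \<open>auto intro!: summable_mult summable_geometric\<close>)
  also have "\<dots> = norm Q * (1 / (1 - norm Q))"
    using assms by (subst suminf_mult) (auto intro!: summable_geometric simp: suminf_geometric)
  also have "\<dots> \<le> norm Q * 2" using assms by (intro mult_left_mono) (auto simp: divide_le_eq)
  finally show ?thesis by (simp add: mult.commute)
qed

lemma theta2_series_ge_1:
  fixes Q :: real assumes "0 \<le> Q" "Q < 1"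
  shows "theta2_series Q \<ge> 1"
proof -
  have "(\<Sum>m\<in>{0}. Q ^ (4 * m * (m + 1))) \<le> theta2_series Q"
    unfolding theta2_series_def using theta2_series_sums[of Q] assms
    by (intro sum_le_suminf) (auto simp: sums_iff)
  then show ?thesis by simp
qed

section \<open>The modular relation on the right half-plane\<close>

lemma Re_of_real_divide: "Re (of_real c / z) = c * (Re z / (norm z)\<^sup>2)"
  by (simp add: Re_divide cmod_power2)

lemma Re_of_real_divide_pos:
  assumes "Re z > 0" "c > 0" shows "Re (of_real c / z) > 0"
proof -
  have "z \<noteq> 0" using assms by auto
  then show ?thesis unfolding Re_of_real_divide using assms by simp
qed

lemma overp_gf_modular_real:
  fixes t :: real assumes t: "t > 0"
  defines "Q \<equiv> exp (- pi\<^sup>2 / (4 * t))"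
  shows "overp_gf (of_real (exp (- t))) * of_real (2 * sqrt pi * Q * theta2_series Q) = of_real (sqrt t)"
proof -
  have "overp_gf (of_real (exp (- t))) * of_real (theta4 (exp (- t))) = 1"
    by (rule overp_gf_times_theta4_real) (use t in auto)
  then have "overp_gf (of_real (exp (- t))) * of_real (2 * sqrt (pi / t) * Q * theta2_series Q) * of_real (sqrt t)
      = of_real (sqrt t)"
    unfolding theta4_transformation_real[OF t] Q_def by simp
  moreover have "2 * sqrt (pi / t) * Q * theta2_series Q * sqrt t = 2 * sqrt pi * Q * theta2_series Q"
    using t by (simp add: real_sqrt_divide)
  ultimately show ?thesis
    by (metis (no_types, lifting) of_real_mult mult.assoc)
qed

text \<open>Analytic continuation from the positive real axis. In this form, free of division, both
  sides are holomorphic without any knowledge of the zeros of \<open>theta2_series\<close>.\<close>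

theorem overp_gf_modular:
  assumes z: "Re z > 0"
  defines "Q \<equiv> exp (- of_real (pi\<^sup>2 / 4) / z)"
  shows "overp_gf (exp (- z)) * (2 * of_real (sqrt pi) * Q * theta2_series Q) = csqrt z"
proof -
  let ?Q = "\<lambda>z. exp (- of_real (pi\<^sup>2 / 4) / z) :: complex"
  let ?f = "\<lambda>z. overp_gf (exp (- z)) * (2 * of_real (sqrt pi) * ?Q z * theta2_series (?Q z)) - csqrt z"
  let ?S = "{z. Re z > 0}"
  let ?U = "of_real ` {0::real<..} :: complex set"
  have S: "open ?S" "connected ?S"
    by (auto intro: open_halfspace_Re_gt convex_connected convex_halfspace_Re_gt)
  have Qb: "norm (?Q z) < 1" if "Re z > 0" for z
    using Re_of_real_divide_pos[OF that, of "pi\<^sup>2 / 4"] by simp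
  have "?f z = 0"
  proof (rule analytic_continuation[of ?f ?S ?U 1])
    have "(\<lambda>z. overp_gf (exp (- z))) holomorphic_on ?S"
      by (rule holomorphic_on_compose_gen[OF _ overp_gf_holomorphic, unfolded o_def])
         (auto intro!: holomorphic_intros)
    moreover have "(\<lambda>z. theta2_series (?Q z)) holomorphic_on ?S"
    proof (rule holomorphic_on_compose_gen[OF _ theta2_series_holomorphic, unfolded o_def])
      show "?Q holomorphic_on ?S" by (intro holomorphic_intros) auto
      show "?Q ` ?S \<subseteq> ball 0 1" using Qb by (auto simp del: norm_exp_eq_Re)
    qed
    moreover have "csqrt holomorphic_on ?S"
      by (rule holomorphic_on_subset[OF holomorphic_on_csqrt]) (auto simp: complex_nonpos_Reals_iff)
    ultimately show "?f holomorphic_on ?S"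
      by (intro holomorphic_intros) (auto simp: complex_nonpos_Reals_iff)
    show "(1::complex) islimpt ?U"
      unfolding islimpt_sequential
    proof (intro exI conjI allI)
      fix n :: nat
      have "complex_of_real (1 + 1 / real (Suc n)) \<noteq> 1"
        unfolding of_real_eq_1_iff by simp
      moreover have "complex_of_real (1 + 1 / real (Suc n)) \<in> ?U"
        by (rule imageI) (simp add: add_pos_nonneg)
      ultimately show "complex_of_real (1 + 1 / real (Suc n)) \<in> ?U - {1}" by blast
    next
      have "(\<lambda>n. 1 + 1 / real (Suc n)) \<longlonglongrightarrow> 1 + 0"
        by (intro tendsto_intros) (rule LIMSEQ_Suc[OF lim_1_over_n])
      from tendsto_of_real[OF this, where 'a=complex]
      show "(\<lambda>n. complex_of_real (1 + 1 / real (Suc n))) \<longlonglongrightarrow> 1" by simp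
    qed
    fix u assume "u \<in> ?U"
    then obtain t where t: "t > 0" "u = of_real t" by auto
    define q where "q = exp (- pi\<^sup>2 / (4 * t))"
    have q: "0 \<le> q" "q < 1" using t by (auto simp: q_def)
    have Qq: "?Q u = of_real q" by (simp add: q_def t exp_of_real[symmetric])
    have "theta2_series (complex_of_real q) = of_real (theta2_series q)"
      using sums_of_real[OF theta2_series_sums[of q], where 'a=complex] theta2_series_sums[of "complex_of_real q"] q
      by (auto dest: sums_unique2)
    moreover have "exp (- u) = of_real (exp (- t))" by (simp add: t exp_of_real[symmetric])
    ultimately show "?f u = 0"
      using overp_gf_modular_real[OF t(1)] t unfolding Qq by (simp add: q_def)
  qed (use S z in auto)
  then show ?thesis by (simp add: Q_def)
qed

text \<open>The main term grows like 1 / |Q|, but its relative error is about 1 -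
  \<open>theta2_series Q\<close>, of size at most 2 |Q|; the two cancel and leave a bounded absolute
  error.\<close>

lemma overp_gf_near_1:
  assumes z: "Re z > 0" and small: "norm (exp (- of_real (pi\<^sup>2 / 4) / z) :: complex) \<le> 1 / 4"
  shows "norm (overp_gf (exp (- z)) - csqrt z * exp (of_real (pi\<^sup>2 / 4) / z) / of_real (2 * sqrt pi))
           \<le> 2 * sqrt (norm z)"
proof -
  define Q where "Q = (exp (- of_real (pi\<^sup>2 / 4) / z) :: complex)"
  define \<theta> where "\<theta> = theta2_series Q"
  have Q0: "Q \<noteq> 0" by (simp add: Q_def)
  have \<theta>1: "norm (\<theta> - 1) \<le> 2 * norm Q"
    unfolding \<theta>_def using small by (intro norm_theta2_series_minus_1_le) (simp add: Q_def)
  then have "norm (\<theta> - 1) \<le> 1 / 2" using small by (simp add: Q_def)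
  then have \<theta>2: "norm \<theta> \<ge> 1 / 2"
    using norm_triangle_ineq2[of 1 "1 - \<theta>"] by (simp add: norm_minus_commute)
  then have \<theta>0: "\<theta> \<noteq> 0" by auto
  have E: "exp (of_real (pi\<^sup>2 / 4) / z) = inverse Q" by (simp add: Q_def exp_minus[symmetric])
  have mod: "overp_gf (exp (- z)) * (2 * of_real (sqrt pi) * Q * \<theta>) = csqrt z"
    unfolding \<theta>_def Q_def by (rule overp_gf_modular[OF z])
  have "overp_gf (exp (- z)) = csqrt z / (2 * of_real (sqrt pi) * Q * \<theta>)"
    using mod Q0 \<theta>0 by (simp add: field_simps)
  then have "overp_gf (exp (- z)) - csqrt z * exp (of_real (pi\<^sup>2 / 4) / z) / of_real (2 * sqrt pi) =
      csqrt z / of_real (2 * sqrt pi) * ((1 - \<theta>) / (Q * \<theta>))"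
    using Q0 \<theta>0 unfolding E by (simp add: field_simps)
  also have "norm \<dots> = sqrt (norm z) / (2 * sqrt pi) * (norm (1 - \<theta>) / (norm Q * norm \<theta>))"
    by (simp add: norm_mult norm_divide)
  also have "\<dots> \<le> sqrt (norm z) / 2 * 4"
  proof (intro mult_mono)
    have "sqrt pi \<ge> 1" using pi_gt3 by simp
    then show "sqrt (norm z) / (2 * sqrt pi) \<le> sqrt (norm z) / 2" by (intro divide_left_mono) auto
    have "norm (1 - \<theta>) / (norm Q * norm \<theta>) \<le> (2 * norm Q) / (norm Q * (1 / 2))"
      using \<theta>1 \<theta>2 Q0 by (intro frac_le mult_left_mono) (auto simp: norm_minus_commute)
    then show "norm (1 - \<theta>) / (norm Q * norm \<theta>) \<le> 4" using Q0 by simp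
  qed auto
  finally show ?thesis by simp
qed

text \<open>On the real axis \<open>theta2_series\<close> is at least 1, so no smallness of
  \<open>y\<close> is needed. This is the maximum on the circle, from which the minor arc saves a
  factor.\<close>

lemma norm_overp_gf_real_le:
  assumes y: "y > 0"
  shows "norm (overp_gf (of_real (exp (- y)))) \<le> sqrt y * exp (pi\<^sup>2 / (4 * y))"
proof -
  define Q where "Q = exp (- pi\<^sup>2 / (4 * y))"
  have Q: "0 < Q" "Q < 1" using y by (auto simp: Q_def)
  have \<theta>: "theta2_series Q \<ge> 1" by (rule theta2_series_ge_1) (use Q in auto)
  have "1 * 1 \<le> (2 * sqrt pi) * theta2_series Q"
    using pi_gt3 \<theta> by (intro mult_mono) (auto intro: order_trans[of 1 2])
  then have "norm (overp_gf (of_real (exp (- y)))) * Q * 1 \<le>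
      norm (overp_gf (of_real (exp (- y)))) * Q * (2 * sqrt pi * theta2_series Q)"
    using Q by (intro mult_left_mono) auto
  also have "\<dots> = norm (overp_gf (of_real (exp (- y))) * of_real (2 * sqrt pi * Q * theta2_series Q))"
    using Q \<theta> by (simp add: norm_mult)
  also have "\<dots> = sqrt y"
    unfolding Q_def overp_gf_modular_real[OF y] using y by simp
  finally have "norm (overp_gf (of_real (exp (- y)))) * Q * exp (pi\<^sup>2 / (4 * y)) \<le> sqrt y * exp (pi\<^sup>2 / (4 * y))"
    by (intro mult_right_mono) auto
  then show ?thesis by (simp add: Q_def mult_exp_exp mult.assoc)
qed

text \<open>All coefficients of \<open>ln ((1 + w) / (1 - w))\<close> are nonnegative, so the loss in passing to
  absolute values is at least the loss in the linear term.\<close>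

lemma norm_overp_factor_le:
  fixes w :: complex assumes w: "norm w < 1"
  shows "norm ((1 + w) / (1 - w)) \<le> (1 + norm w) / (1 - norm w) * exp (- 2 * (norm w - Re w))"
proof -
  define a where "a = (\<lambda>n::nat. (1 - (-1) ^ n) / real n)"
  have a: "a n \<ge> 0" for n by (auto simp: a_def minus_one_power_iff)
  have L: "(\<lambda>n. of_real (a n) * v ^ n) sums (ln (1 + v) - ln (1 - v))" if "norm v < 1" for v :: complex
  proof -
    have "(\<lambda>n. (-1) ^ Suc n / of_nat n * v ^ n - (-1) ^ Suc n / of_nat n * (- v) ^ n) sums
            (ln (1 + v) - ln (1 + (- v)))"
      using that by (intro sums_diff Ln_series) auto
    moreover have "(-1) ^ Suc n / of_nat n * v ^ n - (-1) ^ Suc n / of_nat n * (- v) ^ n = of_real (a n) * v ^ n" for n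
      by (simp add: a_def power_minus[of v] diff_divide_distrib algebra_simps minus_one_power_iff)
    ultimately show ?thesis by simp
  qed
  have exp_L: "exp (ln (1 + v) - ln (1 - v)) = (1 + v) / (1 - v)" if "norm v < 1" for v :: complex
  proof -
    have "1 + v \<noteq> 0" "1 - v \<noteq> 0" using that by (auto simp: add_eq_0_iff)
    then show ?thesis by (simp add: exp_diff)
  qed
  define r where "r = norm w"
  have r: "0 \<le> r" "r < 1" using w by (auto simp: r_def)
  let ?L = "\<lambda>v::complex. Re (ln (1 + v) - ln (1 - v))"
  have d: "(\<lambda>n. a n * (r ^ n - Re (w ^ n))) sums (?L (of_real r) - ?L w)"
  proof -
    have "(\<lambda>n. Re (of_real (a n) * of_real r ^ n) - Re (of_real (a n) * w ^ n)) sums (?L (of_real r) - ?L w)"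
      using r w by (intro sums_diff sums_Re L) auto
    then show ?thesis by (simp add: algebra_simps flip: of_real_power)
  qed
  have nn: "r ^ n - Re (w ^ n) \<ge> 0" for n
    using complex_Re_le_cmod[of "w ^ n"] by (simp add: r_def norm_power)
  have "(\<Sum>n\<in>{1}. a n * (r ^ n - Re (w ^ n))) \<le> ?L (of_real r) - ?L w"
    unfolding sums_unique[OF d]
    by (intro sum_le_suminf) (use d nn a in \<open>auto simp: sums_iff\<close>)
  then have "2 * (r - Re w) \<le> ?L (of_real r) - ?L w" by (simp add: a_def)
  then have "exp (?L w) \<le> exp (?L (of_real r)) * exp (- 2 * (r - Re w))"
    by (simp flip: exp_add)
  moreover have "exp (?L w) = norm ((1 + w) / (1 - w))"
    unfolding exp_L[OF w, symmetric] norm_exp_eq_Re ..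
  moreover have "exp (?L (of_real r)) = (1 + r) / (1 - r)"
  proof -
    have e: "exp (ln (1 + complex_of_real r) - ln (1 - of_real r)) = (1 + of_real r) / (1 - of_real r)"
      by (rule exp_L) (use r in simp)
    have "exp (?L (of_real r)) = norm ((1 + complex_of_real r) / (1 - of_real r))"
      unfolding e[symmetric] norm_exp_eq_Re ..
    also have "(1 + complex_of_real r) / (1 - of_real r) = of_real ((1 + r) / (1 - r))" by simp
    also have "norm (complex_of_real ((1 + r) / (1 - r))) = (1 + r) / (1 - r)"
      using r by (simp only: norm_of_real) simp
    finally show ?thesis .
  qed
  ultimately show ?thesis by (simp add: r_def)
qed

text \<open>Applying \<open>norm_overp_factor_le\<close> to every w = q^n, the losses add up to the
  difference of the geometric series 1 / (1 - |q|) and Re (1 / (1 - q)).\<close>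

lemma norm_overp_gf_le:
  fixes q :: complex assumes q: "norm q < 1"
  shows "norm (overp_gf q) \<le> norm (overp_gf (of_real (norm q))) *
           exp (- 2 * (1 / (1 - norm q) - 1 / norm (1 - q)))"
proof -
  define r where "r = norm q"
  have r: "0 \<le> r" "r < 1" using q by (auto simp: r_def)
  \<comment> \<open>The term n = 0 vanishes; including it makes both parts full geometric
    series.\<close>
  define s where "s = (\<lambda>m. \<Sum>n<m. r ^ n - Re (q ^ n))"
  have "norm (overp_prod m q) \<le> norm (overp_prod m (complex_of_real r)) * exp (- 2 * s (Suc m))" for m
  proof -
    have "norm (overp_prod m q) \<le> (\<Prod>n=1..m. (1 + r ^ n) / (1 - r ^ n) * exp (- 2 * (r ^ n - Re (q ^ n))))"
      unfolding overp_prod_def prod_norm[symmetric]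
    proof (intro prod_mono conjI norm_ge_zero)
      fix n assume "n \<in> {1..m}"
      then have "norm (q ^ n) < 1" using q by (simp add: norm_power power_less_one_iff)
      from norm_overp_factor_le[OF this]
      show "norm ((1 + q ^ n) / (1 - q ^ n)) \<le> (1 + r ^ n) / (1 - r ^ n) * exp (- 2 * (r ^ n - Re (q ^ n)))"
        by (simp only: norm_power r_def)
    qed
    also have "\<dots> = overp_prod m r * exp (\<Sum>n=1..m. - 2 * (r ^ n - Re (q ^ n)))"
      by (simp only: overp_prod_def prod.distrib exp_sum[OF finite_atLeastAtMost])
    also have "(\<Sum>n=1..m. - 2 * (r ^ n - Re (q ^ n))) = - 2 * s (Suc m)"
      unfolding s_def sum_distrib_left[symmetric] sum.lessThan_Suc_shift[of _ m]
      by (simp add: sum.atLeast1_atMost_eq)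
    also have "overp_prod m r = norm (overp_prod m (complex_of_real r))"
    proof -
      have "overp_prod m (complex_of_real r) = of_real (overp_prod m r)" by (simp add: overp_prod_def)
      moreover have "overp_prod m r \<ge> 0"
        unfolding overp_prod_def using r by (intro prod_nonneg divide_nonneg_nonneg ballI) (auto simp: power_le_one)
      ultimately show ?thesis by simp
    qed
    finally show ?thesis .
  qed
  note bound = this
  have "s \<longlonglongrightarrow> 1 / (1 - r) - Re (1 / (1 - q))"
    unfolding s_def sum_subtractf using r q
    by (intro tendsto_diff) (auto simp flip: sums_def intro!: geometric_sums sums_Re)
  then have "(\<lambda>m. s (Suc m)) \<longlonglongrightarrow> 1 / (1 - r) - Re (1 / (1 - q))" by (rule LIMSEQ_Suc)
  then have "(\<lambda>m. norm (overp_prod m (complex_of_real r)) * exp (- 2 * s (Suc m))) \<longlonglongrightarrow>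
      norm (overp_gf (of_real r)) * exp (- 2 * (1 / (1 - r) - Re (1 / (1 - q))))"
    using r by (intro tendsto_intros overp_prod_tendsto) auto
  moreover have "(\<lambda>m. norm (overp_prod m q)) \<longlonglongrightarrow> norm (overp_gf q)"
    by (intro tendsto_norm overp_prod_tendsto q)
  ultimately have "norm (overp_gf q) \<le> norm (overp_gf (of_real r)) * exp (- 2 * (1 / (1 - r) - Re (1 / (1 - q))))"
    using bound by (intro LIMSEQ_le[of _ _ "\<lambda>m. norm (overp_prod m (complex_of_real r)) * exp (- 2 * s (Suc m))"]) auto
  also have "\<dots> \<le> norm (overp_gf (of_real r)) * exp (- 2 * (1 / (1 - r) - 1 / norm (1 - q)))"
    using complex_Re_le_cmod[of "1 / (1 - q)"]
    by (intro mult_left_mono) (auto simp: norm_divide)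
  finally show ?thesis by (simp add: r_def)
qed

section \<open>The minor arc\<close>

lemma sin_ge_linear:
  assumes "0 \<le> x" "x \<le> pi / 2"
  shows "2 * x / pi \<le> sin x"
proof -
  \<comment> \<open>Jordan's inequality: concavity of sin puts it above its chord from 0 to pi /
    2.\<close>
  have "convex_on {0..pi} (\<lambda>x. - sin x)"
    by (rule f''_ge0_imp_convex[where f' = "\<lambda>x. - cos x" and f'' = sin])
       (auto intro!: derivative_eq_intros sin_ge_zero)
  from convex_onD[OF this, of "2 * x / pi" 0 "pi / 2"] show ?thesis
    using assms by (simp add: field_simps)
qed

lemma norm_one_minus_exp_sq_ge:
  assumes y: "y > 0" and t: "\<bar>t\<bar> \<le> pi"
  shows "(norm (1 - exp (- Complex y t)))\<^sup>2 \<ge> (1 - exp (- y))\<^sup>2 + 4 * exp (- y) * (t / pi)\<^sup>2"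
proof -
  define r where "r = exp (- y)"
  have "(norm (1 - exp (- Complex y t)))\<^sup>2 = (1 - r * cos t)\<^sup>2 + (r * sin t)\<^sup>2"
    unfolding cmod_power2 by (simp add: Re_exp Im_exp r_def)
  also have "\<dots> = 1 - 2 * r * cos t + r\<^sup>2 * ((sin t)\<^sup>2 + (cos t)\<^sup>2)"
    by algebra
  also have "\<dots> = 1 - 2 * r * cos t + r\<^sup>2" by simp
  also have "\<dots> = 1 - 2 * r * (1 - 2 * (sin (\<bar>t\<bar> / 2))\<^sup>2) + r\<^sup>2"
    using cos_double_sin[of "\<bar>t\<bar> / 2"] by simp
  also have "\<dots> = (1 - r)\<^sup>2 + 4 * r * (sin (\<bar>t\<bar> / 2))\<^sup>2"
    by algebra
  finally have eq: "(norm (1 - exp (- Complex y t)))\<^sup>2 = (1 - r)\<^sup>2 + 4 * r * (sin (\<bar>t\<bar> / 2))\<^sup>2" .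
  have "2 * (\<bar>t\<bar> / 2) / pi \<le> sin (\<bar>t\<bar> / 2)" by (rule sin_ge_linear) (use t in auto)
  then have "(\<bar>t\<bar> / pi)\<^sup>2 \<le> (sin (\<bar>t\<bar> / 2))\<^sup>2" by (intro power_mono) auto
  then have "4 * r * (t / pi)\<^sup>2 \<le> 4 * r * (sin (\<bar>t\<bar> / 2))\<^sup>2"
    by (intro mult_left_mono) (auto simp: r_def power_divide)
  then show ?thesis unfolding eq by (simp add: r_def)
qed

text \<open>The ratio 3/4 is that of the half-length 3/5 to the abscissa 4/5 of the segment used in
  \<open>saddle_integral\<close>. On this arc |1 - q| exceeds 1 - |q| by at least a tenth, so a
  fixed share 1/11 of 1 / (1 - |q|) is saved.\<close>

lemma overp_gf_minor_arc:
  assumes y: "y > 0" "exp (- y) \<ge> 14 / 15" and t: "3 / 4 * y \<le> \<bar>t\<bar>" "\<bar>t\<bar> \<le> pi"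
  shows "norm (overp_gf (exp (- Complex y t))) \<le> sqrt y * exp (pi\<^sup>2 / (4 * y) - 2 / (11 * y))"
proof -
  define r where "r = exp (- y)"
  define q where "q = exp (- Complex y t)"
  have r: "0 < r" "r < 1" "14 / 15 \<le> r" using y by (auto simp: r_def)
  have nq: "norm q = r" by (simp add: q_def r_def)
  have y_ge: "1 - r \<le> y" unfolding r_def using exp_ge_add_one_self[of "- y"] by simp
  have "pi\<^sup>2 \<le> 10" 
  proof -
    have "pi \<le> 3.16" using pi_less_4 pi_approx by simp
    then have "pi\<^sup>2 \<le> 3.16\<^sup>2" by (intro power_mono) auto
    then show ?thesis by (simp add: power2_eq_square)
  qed
  have "(3 / 4 * (1 - r))\<^sup>2 \<le> \<bar>t\<bar>\<^sup>2" using y_ge t r by (intro power_mono) auto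
  moreover have "(3 / 4 * (1 - r))\<^sup>2 = 9 / 16 * (1 - r)\<^sup>2"
    by (subst power_mult_distrib) (simp add: power_divide)
  ultimately have "9 / 16 * (1 - r)\<^sup>2 \<le> t\<^sup>2" by simp
  then have "(9 / 16 * (1 - r)\<^sup>2) / 10 \<le> t\<^sup>2 / pi\<^sup>2"
    using \<open>pi\<^sup>2 \<le> 10\<close> by (intro frac_le) auto
  then have "4 * r * ((9 / 16 * (1 - r)\<^sup>2) / 10) \<le> 4 * r * (t / pi)\<^sup>2"
    using r by (intro mult_left_mono) (auto simp: power_divide)
  \<comment> \<open>4 * (14/15) * (9/16) / 10 = 21/100, and 1 + 21/100 = (11/10)^2.\<close>
  moreover have "4 * (14 / 15) * ((9 / 16 * (1 - r)\<^sup>2) / 10) \<le> 4 * r * ((9 / 16 * (1 - r)\<^sup>2) / 10)"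
    using r by (intro mult_right_mono) auto
  ultimately have "(1 - r)\<^sup>2 + 21 / 100 * (1 - r)\<^sup>2 \<le> (norm (1 - q))\<^sup>2"
    using norm_one_minus_exp_sq_ge[OF y(1) t(2)] unfolding q_def r_def[symmetric] by simp
  moreover have "(11 / 10 * (1 - r))\<^sup>2 = 121 / 100 * (1 - r)\<^sup>2"
    by (subst power_mult_distrib) (simp add: power_divide)
  ultimately have "(11 / 10 * (1 - r))\<^sup>2 \<le> (norm (1 - q))\<^sup>2" by linarith
  then have "11 / 10 * (1 - r) \<le> norm (1 - q)" by (rule power2_le_imp_le) simp
  moreover have "norm (1 - q) > 0" by (rule less_le_trans[OF _ calculation]) (use r in simp)
  ultimately have "1 / norm (1 - q) \<le> 1 / (11 / 10 * (1 - r))"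
    using r by (intro divide_left_mono mult_pos_pos) auto
  moreover have "1 / (11 / 10 * (1 - r)) = 10 / 11 * (1 / (1 - r))" by simp
  moreover have "c - a \<ge> (1 / 11) * c" if "a \<le> b" "b = 10 / 11 * c" for a b c :: real
    using that by linarith
  ultimately have "1 / (1 - r) - 1 / norm (1 - q) \<ge> (1 / 11) * (1 / (1 - r))"
    by blast
  moreover have "1 / (1 - r) \<ge> 1 / y" using y y_ge r by (intro divide_left_mono) auto
  moreover have "2 * (c - a) \<ge> 2 / 11 * b" if "c - a \<ge> (1 / 11) * c" "c \<ge> b" for a b c :: real
    using that by (simp add: field_simps)
  ultimately have "2 * (1 / (1 - r) - 1 / norm (1 - q)) \<ge> 2 / 11 * (1 / y)" by blast
  then have save: "2 * (1 / (1 - r) - 1 / norm (1 - q)) \<ge> 2 / (11 * y)" by simp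
  have "norm (overp_gf q) \<le> norm (overp_gf (of_real r)) * exp (- 2 * (1 / (1 - r) - 1 / norm (1 - q)))"
    using norm_overp_gf_le[of q] r nq by simp
  also have "\<dots> \<le> (sqrt y * exp (pi\<^sup>2 / (4 * y))) * exp (- (2 / (11 * y)))"
    using save norm_overp_gf_real_le[OF y(1)] y unfolding r_def[symmetric]
    by (intro mult_mono) (auto simp del: mult_minus_left)
  finally show ?thesis unfolding q_def by (simp add: mult.assoc flip: exp_add)
qed

section \<open>The circle method\<close>

lemma has_integral_exp_int_mult:
  "((\<lambda>t. exp (of_int j * Complex y t)) has_integral (if j = 0 then 2 * pi else 0)) {- pi..pi}"
proof (cases "j = 0")
  case True
  then show ?thesis using has_integral_const_real[of "1::complex" "- pi" pi]
    by (simp add: scaleR_conv_of_real)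
next
  case False
  let ?G = "\<lambda>t. exp (of_int j * Complex y t) / (\<i> * of_int j)"
  have eq: "Complex y t = of_real y + \<i> * of_real t" for t by (simp add: complex_eq_iff)
  have "((\<lambda>t. exp (of_int j * Complex y t)) has_integral (?G pi - ?G (- pi))) {- pi..pi}"
  proof (rule fundamental_theorem_of_calculus)
    fix t assume "t \<in> {- pi..pi}"
    have "((\<lambda>x. exp (of_int j * (of_real y + \<i> * x)) / (\<i> * of_int j)) has_field_derivative
             exp (of_int j * (of_real y + \<i> * of_real t))) (at (of_real t))"
      using False by (auto intro!: derivative_eq_intros)
    then have "((\<lambda>t. exp (of_int j * (of_real y + \<i> * of_real t)) / (\<i> * of_int j)) has_vector_derivative
             exp (of_int j * (of_real y + \<i> * of_real t))) (at t)"
      by (rule has_vector_derivative_real_field)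
    then show "(?G has_vector_derivative exp (of_int j * Complex y t)) (at t within {- pi..pi})"
      unfolding eq by (rule has_vector_derivative_at_within)
  qed auto
  moreover have "exp (of_int j * Complex y pi) = exp (of_int j * Complex y (- pi))"
    unfolding exp_eq by (intro exI[of _ j]) (simp add: complex_eq_iff algebra_simps)
  ultimately show ?thesis using False by simp
qed

lemma overp_gf_exp_continuous:
  assumes "y > 0"
  shows "continuous_on A (\<lambda>t. overp_gf (exp (- Complex y t)))"
proof (rule continuous_on_compose2[OF holomorphic_on_imp_continuous_on[OF overp_gf_holomorphic]])
  show "continuous_on A (\<lambda>t. exp (- Complex y t))"
    unfolding Complex_eq by (intro continuous_intros)
  show "(\<lambda>t. exp (- Complex y t)) ` A \<subseteq> ball 0 1" using assms by auto
qed

text \<open>Cauchy's coefficient formula on the circle of radius exp (- y), obtained from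
  orthogonality and uniform convergence as an integral over a real interval, the form that can be
  cut into arcs.\<close>

theorem overp_Cauchy_integral:
  assumes y: "y > 0"
  shows "((\<lambda>t. overp_gf (exp (- Complex y t)) * exp (of_nat n * Complex y t)) has_integral
            of_real (2 * pi * real (overp n))) {- pi..pi}"
proof -
  let ?f = "\<lambda>k t. of_nat (overp k) * exp (- Complex y t) ^ k * exp (of_nat n * Complex y t)"
  let ?g = "\<lambda>t. overp_gf (exp (- Complex y t)) * exp (of_nat n * Complex y t)"
  have fk: "(?f k has_integral (if k = n then of_real (2 * pi * real (overp n)) else 0)) {- pi..pi}" for k
  proof -
    have eq: "?f k = (\<lambda>t. of_nat (overp k) * exp (of_int (int n - int k) * Complex y t))"
      by (simp add: fun_eq_iff exp_of_nat_mult[symmetric] exp_add[symmetric] mult.assoc left_diff_distrib)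
    have val: "(if k = n then of_real (2 * pi * real (overp n)) else 0) =
        of_nat (overp k) * complex_of_real (if int n - int k = 0 then 2 * pi else 0)" by auto
    show ?thesis unfolding eq val by (rule has_integral_mult_right[OF has_integral_exp_int_mult])
  qed
  define B where "B = (\<lambda>k. real (overp k) * exp (- y) ^ k * exp (real n * y))"
  have B: "summable B" unfolding B_def
    by (intro summable_mult2 summable_overp) (use y in auto)
  have "uniform_limit {- pi..pi} (\<lambda>N t. \<Sum>k<N. ?f k t) (\<lambda>t. \<Sum>k. ?f k t) sequentially"
    by (rule Weierstrass_m_test[OF _ B])
       (simp add: B_def norm_mult norm_power)
  moreover have "(\<Sum>k. ?f k t) = ?g t" for t
  proof -
    have "(\<lambda>k. of_nat (overp k) * exp (- Complex y t) ^ k) sums overp_gf (exp (- Complex y t))"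
      by (rule overp_gf_sums) (use y in simp)
    from sums_mult2[OF this] show ?thesis by (simp add: sums_iff)
  qed
  ultimately have ul: "uniform_limit {- pi..pi} (\<lambda>N t. \<Sum>k<N. ?f k t) ?g sequentially" by simp
  have cont: "continuous_on {- pi..pi} (\<lambda>t. \<Sum>k<N. ?f k t)" for N
    unfolding Complex_eq by (intro continuous_intros)
  obtain I J where IJ: "\<And>N. ((\<lambda>t. \<Sum>k<N. ?f k t) has_integral I N) {- pi..pi}"
    "(?g has_integral J) {- pi..pi}" "I \<longlonglongrightarrow> J"
    by (rule uniform_limit_integral[OF ul cont sequentially_bot]) (rule that)
  have "I N = (\<Sum>k<N. if k = n then of_real (2 * pi * real (overp n)) else 0)" for N
    by (rule has_integral_unique[OF IJ(1) has_integral_sum]) (use fk in auto)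
  then have "\<forall>\<^sub>F N in sequentially. I N = of_real (2 * pi * real (overp n))"
    by (intro eventually_mono[OF eventually_gt_at_top[of n]]) simp
  then have "I \<longlonglongrightarrow> of_real (2 * pi * real (overp n))" by (rule tendsto_eventually)
  with IJ(3) have "J = of_real (2 * pi * real (overp n))" by (rule LIMSEQ_unique)
  with IJ(2) show ?thesis by simp
qed

section \<open>The saddle integral\<close>

lemma exp_square_primitive:
  obtains G :: "complex \<Rightarrow> complex" where "\<And>u. (G has_field_derivative exp (u\<^sup>2)) (at u)"
proof -
  have "(\<lambda>u::complex. exp (u\<^sup>2)) holomorphic_on UNIV" by (intro holomorphic_intros)
  from holomorphic_convex_primitive'[OF convex_UNIV open_UNIV this] that show ?thesis by auto
qed

text \<open>For |x| > X, half of the exponent is spent on exp (- X^2 / 2) and the other half keeps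
  the integral finite; 3 bounds sqrt (2 pi).\<close>

lemma gaussian_has_integral_truncated:
  assumes X: "X \<ge> 0"
  obtains e where "((\<lambda>x::real. exp (- x\<^sup>2)) has_integral (sqrt pi - e)) {- X..X}"
    "0 \<le> e" "e \<le> 3 * exp (- X\<^sup>2 / 2)"
proof -
  let ?f = "\<lambda>x::real. exp (- x\<^sup>2)" and ?g = "\<lambda>x::real. exp (- x\<^sup>2 / 2)"
  let ?h = "\<lambda>x. indicator {- X..X} x *\<^sub>R ?f x"
  have f: "integrable lborel ?f" "(LINT x|lborel. ?f x) = sqrt pi"
    using gaussian_cos_transform[of 1 0] by (auto simp: has_bochner_integral_iff)
  have g: "integrable lborel ?g" "(LINT x|lborel. ?g x) = sqrt (2 * pi)"
    using gaussian_cos_transform[of "1/2" 0] by (auto simp: has_bochner_integral_iff)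
  have h: "integrable lborel ?h" by (rule integrable_mult_indicator[OF _ f(1)]) simp
  then have "set_integrable lborel {- X..X} ?f" by (simp only: set_integrable_def)
  note S = set_borel_integral_eq_integral[OF this]
  have I: "(?f has_integral (LINT x|lborel. ?h x)) {- X..X}"
    using S(2) integrable_integral[OF S(1)] by (simp only: set_lebesgue_integral_def)
  have "(LINT x|lborel. ?f x) \<le> (LINT x|lborel. ?h x + exp (- X\<^sup>2 / 2) * ?g x)"
  proof (rule integral_mono)
    fix x :: real
    show "?f x \<le> ?h x + exp (- X\<^sup>2 / 2) * ?g x"
    proof (cases "x \<in> {- X..X}")
      case False
      then have "X\<^sup>2 \<le> x\<^sup>2" using X by (auto simp: abs_le_square_iff[symmetric])
      then show ?thesis using False by (simp flip: exp_add)
    qed simp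
  qed (use f g h in auto)
  also have "\<dots> = (LINT x|lborel. ?h x) + exp (- X\<^sup>2 / 2) * sqrt (2 * pi)"
    using g h by (subst Bochner_Integration.integral_add) auto
  finally have 1: "sqrt pi - (LINT x|lborel. ?h x) \<le> exp (- X\<^sup>2 / 2) * sqrt (2 * pi)" using f by simp
  have "sqrt (2 * pi) \<le> sqrt (3\<^sup>2)" using pi_less_4 by (subst real_sqrt_le_iff) simp
  then have "exp (- X\<^sup>2 / 2) * sqrt (2 * pi) \<le> exp (- X\<^sup>2 / 2) * 3" by (intro mult_left_mono) auto
  with 1 have "sqrt pi - (LINT x|lborel. ?h x) \<le> 3 * exp (- X\<^sup>2 / 2)" by linarith
  moreover have "(LINT x|lborel. ?h x) \<le> (LINT x|lborel. ?f x)"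
    by (rule integral_mono) (use f h in \<open>auto simp: indicator_def\<close>)
  ultimately show ?thesis using I f(2) by (intro that[of "sqrt pi - (LINT x|lborel. ?h x)"]) auto
qed

text \<open>With \<open>w\<^sup>2 = z\<close>, both \<open>s * w - pi / (2 * w)\<close> and \<open>s * w + pi / (2 * w)\<close> have a square that
  differs from \<open>pi\<^sup>2 / (4 * z) + s\<^sup>2 * z\<close> by a constant; this makes the integral elementary in
  terms of a primitive of \<open>exp (u\<^sup>2)\<close>.\<close>

lemma saddle_primitive:
  fixes s :: real and G :: "complex \<Rightarrow> complex"
  assumes G: "\<And>u. (G has_field_derivative exp (u\<^sup>2)) (at u)" and s: "s > 0" and z: "Re z > 0"
  defines "E \<equiv> (\<lambda>z. exp (of_real (pi\<^sup>2 / 4) / z + of_real (s\<^sup>2) * z))"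
  shows "((\<lambda>z. (csqrt z * E z
             + of_real (exp (pi * s) * (pi / 2 - 1 / (2 * s))) * G (of_real s * csqrt z - of_real (pi / 2) / csqrt z)
             - of_real (exp (- pi * s) * (pi / 2 + 1 / (2 * s))) * G (of_real s * csqrt z + of_real (pi / 2) / csqrt z))
             / of_real (s\<^sup>2)) has_field_derivative csqrt z * E z) (at z)"
proof -
  define w where "w = csqrt z"
  define p where "p = complex_of_real (pi / 2)"
  define \<sigma> where "\<sigma> = complex_of_real s"
  have z0: "z \<notin> \<real>\<^sub>\<le>\<^sub>0" "z \<noteq> 0" using z by (auto simp: complex_nonpos_Reals_iff)
  have w0: "w \<noteq> 0" using z0 by (simp add: w_def)
  have zw: "z = w\<^sup>2" by (simp add: w_def)
  have \<sigma>0: "\<sigma> \<noteq> 0" using s by (simp add: \<sigma>_def)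
  define e1 where "e1 = exp (2 * p * \<sigma>)"
  define e2 where "e2 = exp (- 2 * p * \<sigma>)"
  \<comment> \<open>c1 + c2 = 2 p and (c2 - c1) \<sigma> = 1: these conditions remove the terms in 1
    / w^3 and 1 / w from the derivative and leave \<sigma>^2 w E.\<close>
  define c1 where "c1 = p - 1 / (2 * \<sigma>)"
  define c2 where "c2 = p + 1 / (2 * \<sigma>)"
  have Edef: "E = (\<lambda>z. exp (p\<^sup>2 / z + \<sigma>\<^sup>2 * z))"
    by (simp add: E_def p_def \<sigma>_def power_divide fun_eq_iff)
  have eu: "e1 * exp ((\<sigma> * w - p / w)\<^sup>2) = E z"
    unfolding e1_def Edef exp_add[symmetric] zw using w0
    by (intro arg_cong[of _ _ exp]) (simp add: field_simps power2_eq_square)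
  have ev: "e2 * exp ((\<sigma> * w + p / w)\<^sup>2) = E z"
    unfolding e2_def Edef exp_add[symmetric] zw using w0
    by (intro arg_cong[of _ _ exp]) (simp add: field_simps power2_eq_square)
  have dw: "(csqrt has_field_derivative 1 / (2 * w)) (at z)"
    using has_field_derivative_csqrt[OF z0(1)] by (simp add: w_def field_simps)
  have dE: "(E has_field_derivative E z * (\<sigma>\<^sup>2 - p\<^sup>2 / z\<^sup>2)) (at z)"
    unfolding Edef using z0 by (auto intro!: derivative_eq_intros simp: power2_eq_square field_simps)
  have d1: "((\<lambda>z. p / csqrt z) has_field_derivative - (p / w\<^sup>2 * (1 / (2 * w)))) (at z)"
    by (rule DERIV_cong[OF DERIV_divide[OF DERIV_const dw]])
       (use w0 in \<open>simp_all add: w_def power2_eq_square\<close>)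
  have du: "((\<lambda>z. \<sigma> * csqrt z - p / csqrt z) has_field_derivative (\<sigma> + p / w\<^sup>2) * (1 / (2 * w))) (at z)"
    by (rule DERIV_cong[OF DERIV_diff[OF DERIV_cmult[OF dw] d1]]) (simp only: distrib_right minus_minus diff_conv_add_uminus)
  have dv: "((\<lambda>z. \<sigma> * csqrt z + p / csqrt z) has_field_derivative (\<sigma> - p / w\<^sup>2) * (1 / (2 * w))) (at z)"
  proof (rule DERIV_cong[OF DERIV_add[OF DERIV_cmult[OF dw] d1]])
    have "a * c + - (b * c) = (a - b) * c" for a b c :: complex by (simp add: left_diff_distrib)
    then show "\<sigma> * (1 / (2 * w)) + - (p / w\<^sup>2 * (1 / (2 * w))) = (\<sigma> - p / w\<^sup>2) * (1 / (2 * w))" .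
  qed
  have dGu: "((\<lambda>z. G (\<sigma> * csqrt z - p / csqrt z)) has_field_derivative
          exp ((\<sigma> * w - p / w)\<^sup>2) * ((\<sigma> + p / w\<^sup>2) * (1 / (2 * w)))) (at z)"
    using DERIV_chain2[OF G du] by (simp add: w_def)
  have dGv: "((\<lambda>z. G (\<sigma> * csqrt z + p / csqrt z)) has_field_derivative
          exp ((\<sigma> * w + p / w)\<^sup>2) * ((\<sigma> - p / w\<^sup>2) * (1 / (2 * w)))) (at z)"
    using DERIV_chain2[OF G dv] by (simp add: w_def)
  have "((\<lambda>z. (csqrt z * E z + e1 * c1 * G (\<sigma> * csqrt z - p / csqrt z)
             - e2 * c2 * G (\<sigma> * csqrt z + p / csqrt z)) / \<sigma>\<^sup>2) has_field_derivative
        (1 / (2 * w) * E z + E z * (\<sigma>\<^sup>2 - p\<^sup>2 / z\<^sup>2) * csqrt z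
          + e1 * c1 * (exp ((\<sigma> * w - p / w)\<^sup>2) * ((\<sigma> + p / w\<^sup>2) * (1 / (2 * w))))
          - e2 * c2 * (exp ((\<sigma> * w + p / w)\<^sup>2) * ((\<sigma> - p / w\<^sup>2) * (1 / (2 * w))))) / \<sigma>\<^sup>2) (at z)"
    by (intro DERIV_cdivide DERIV_diff DERIV_add DERIV_mult dw dE DERIV_cmult dGu dGv)
  also have "(1 / (2 * w) * E z + E z * (\<sigma>\<^sup>2 - p\<^sup>2 / z\<^sup>2) * csqrt z
          + e1 * c1 * (exp ((\<sigma> * w - p / w)\<^sup>2) * ((\<sigma> + p / w\<^sup>2) * (1 / (2 * w))))
          - e2 * c2 * (exp ((\<sigma> * w + p / w)\<^sup>2) * ((\<sigma> - p / w\<^sup>2) * (1 / (2 * w))))) =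
        (1 / (2 * w) * E z + E z * (\<sigma>\<^sup>2 - p\<^sup>2 / z\<^sup>2) * w
          + c1 * ((e1 * exp ((\<sigma> * w - p / w)\<^sup>2)) * ((\<sigma> + p / w\<^sup>2) * (1 / (2 * w))))
          - c2 * ((e2 * exp ((\<sigma> * w + p / w)\<^sup>2)) * ((\<sigma> - p / w\<^sup>2) * (1 / (2 * w)))))"
    by (simp add: w_def[symmetric] mult_ac)
  also have "\<dots> = E z * (1 / (2 * w) + (\<sigma>\<^sup>2 - p\<^sup>2 / w ^ 4) * w
          + c1 * ((\<sigma> + p / w\<^sup>2) * (1 / (2 * w))) - c2 * ((\<sigma> - p / w\<^sup>2) * (1 / (2 * w))))"
    unfolding eu ev by (simp add: zw algebra_simps)
  also have "1 / (2 * w) + (\<sigma>\<^sup>2 - p\<^sup>2 / w ^ 4) * w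
          + c1 * ((\<sigma> + p / w\<^sup>2) * (1 / (2 * w))) - c2 * ((\<sigma> - p / w\<^sup>2) * (1 / (2 * w))) = \<sigma>\<^sup>2 * w"
    unfolding c1_def c2_def using w0 \<sigma>0 by (simp add: field_simps) algebra
  also have "E z * (\<sigma>\<^sup>2 * w) / \<sigma>\<^sup>2 = csqrt z * E z" using \<sigma>0 by (simp add: w_def)
  finally show ?thesis
    unfolding e1_def e2_def c1_def c2_def p_def \<sigma>_def
    by (simp flip: exp_of_real of_real_power add: mult_ac)
qed

text \<open>By the 3-4-5 triangle the segment ends on the circle |z| = Y. There s w - pi / (2 w) is
  imaginary, so the first \<open>G\<close> term becomes a truncated Gaussian integral and supplies
  sqrt pi; s w + pi / (2 w) is real and equal at both ends, so the second cancels.\<close>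

lemma saddle_integral:
  fixes s :: real
  assumes s: "s \<ge> 2"
  defines "Y \<equiv> pi / (2 * s)"
  obtains I where
    "((\<lambda>t. csqrt (Complex (4 / 5 * Y) t) *
        exp (of_real (pi\<^sup>2 / 4) / Complex (4 / 5 * Y) t + of_real (s\<^sup>2) * Complex (4 / 5 * Y) t))
      has_integral I) {- (3 / 5 * Y)..3 / 5 * Y}"
    "norm (I - of_real (exp (pi * s) * (pi / 2 - 1 / (2 * s)) * sqrt pi / s\<^sup>2)) \<le> 8 * exp (9 / 10 * pi * s)"
proof -
  obtain G where G: "\<And>u::complex. (G has_field_derivative exp (u\<^sup>2)) (at u)"
    by (rule exp_square_primitive) (rule that)
  define E where "E = (\<lambda>z. exp (of_real (pi\<^sup>2 / 4) / z + of_real (s\<^sup>2) * z) :: complex)"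
  define c1 where "c1 = exp (pi * s) * (pi / 2 - 1 / (2 * s))"
  define c2 where "c2 = exp (- pi * s) * (pi / 2 + 1 / (2 * s))"
  define u where "u = (\<lambda>z. of_real s * csqrt z - of_real (pi / 2) / csqrt z)"
  define v where "v = (\<lambda>z. of_real s * csqrt z + of_real (pi / 2) / csqrt z)"
  define \<Psi> where "\<Psi> = (\<lambda>z. (csqrt z * E z + of_real c1 * G (u z) - of_real c2 * G (v z)) / of_real (s\<^sup>2))"
  define y where "y = 4 / 5 * Y"
  define T where "T = 3 / 5 * Y"
  define z1 where "z1 = Complex y T"
  define I where "I = (\<Psi> z1 - \<Psi> (cnj z1)) / \<i>"
  have Y: "0 < Y" "Y \<le> 1" "s * Y = pi / 2"
    using s pi_less_4 by (auto simp: Y_def divide_le_eq)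
  have y: "y > 0" and T: "T > 0" using Y by (auto simp: y_def T_def)
  have int: "((\<lambda>t. csqrt (Complex y t) * E (Complex y t)) has_integral I) {- T..T}"
  proof -
    have "((\<lambda>t. csqrt (Complex y t) * E (Complex y t)) has_integral
             (\<Psi> (Complex y T) / \<i> - \<Psi> (Complex y (- T)) / \<i>)) {- T..T}"
    proof (rule fundamental_theorem_of_calculus)
      fix t assume "t \<in> {- T..T}"
      define z where "z = Complex y t"
      have zt: "z = of_real y + \<i> * of_real t" by (simp add: z_def Complex_eq)
      have "(\<Psi> has_field_derivative csqrt z * E z) (at (of_real y + \<i> * of_real t))"
        unfolding \<Psi>_def u_def v_def c1_def c2_def E_def zt[symmetric]
        by (rule saddle_primitive[OF G]) (use s y in \<open>auto simp: z_def\<close>)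
      then have "((\<lambda>x. \<Psi> (of_real y + \<i> * x)) has_field_derivative csqrt z * E z * \<i>) (at (of_real t))"
        by (rule DERIV_chain2) (auto intro!: derivative_eq_intros)
      then have "((\<lambda>x. \<Psi> (of_real y + \<i> * x) / \<i>) has_field_derivative csqrt z * E z * \<i> / \<i>) (at (of_real t))"
        by (rule DERIV_cdivide)
      then have "((\<lambda>t. \<Psi> (of_real y + \<i> * of_real t) / \<i>) has_vector_derivative csqrt z * E z * \<i> / \<i>) (at t)"
        by (rule has_vector_derivative_real_field)
      then have "((\<lambda>t. \<Psi> (of_real y + \<i> * of_real t) / \<i>) has_vector_derivative csqrt z * E z) (at t)"
        by (simp only: nonzero_mult_div_cancel_right[OF complex_i_not_zero])
      then show "((\<lambda>t. \<Psi> (Complex y t) / \<i>) has_vector_derivative csqrt (Complex y t) * E (Complex y t))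
          (at t within {- T..T})"
        unfolding z_def Complex_eq by (rule has_vector_derivative_at_within)
    qed (use T in auto)
    moreover have "cnj z1 = Complex y (- T)" by (simp add: z1_def complex_eq_iff)
    ultimately show ?thesis unfolding I_def diff_divide_distrib by (simp only: z1_def)
  qed
  define w where "w = csqrt z1"
  have z1: "norm z1 = Y" "z1 \<notin> \<real>\<^sub>\<le>\<^sub>0"
  proof -
    have "norm z1 = sqrt (Y\<^sup>2)"
      unfolding z1_def complex_norm y_def T_def
      by (intro arg_cong[of _ _ sqrt]) (simp add: power2_eq_square)
    then show "norm z1 = Y" using Y by simp
    show "z1 \<notin> \<real>\<^sub>\<le>\<^sub>0" using y by (simp add: complex_nonpos_Reals_iff z1_def)
  qed
  have w2: "w\<^sup>2 = z1" by (simp add: w_def)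
  have wcw: "w * cnj w = of_real Y"
  proof -
    have "(norm w)\<^sup>2 = Y" unfolding norm_power[symmetric] w2 z1 ..
    then show ?thesis by (metis complex_norm_square)
  qed
  have w_cnj: "csqrt (cnj z1) = cnj w" using cnj_csqrt[OF z1(2)] by (simp add: w_def)
  have w0: "w \<noteq> 0" using wcw Y by auto
  have inv: "of_real (pi / 2) / w = of_real s * cnj w" "of_real (pi / 2) / cnj w = of_real s * w"
  proof -
    \<comment> \<open>On |w|^2 = Y = pi / (2 s), dividing pi / 2 by w amounts to s times
      conjugation; this is what the choice of Y is for.\<close>
    have "of_real (pi / 2) = of_real s * (w * cnj w)" unfolding wcw Y(3)[symmetric] by simp
    then show "of_real (pi / 2) / w = of_real s * cnj w" "of_real (pi / 2) / cnj w = of_real s * w"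
      using w0 by (simp_all add: field_simps)
  qed
  define X where "X = 2 * s * Im w"
  have uX: "u z1 = \<i> * of_real X" "u (cnj z1) = \<i> * of_real (- X)" and vX: "v (cnj z1) = v z1"
    unfolding u_def v_def w_cnj w_def[symmetric] inv by (simp_all add: X_def complex_eq_iff)
  have "(Re w)\<^sup>2 - (Im w)\<^sup>2 = y" "2 * Re w * Im w = T"
    using w2 by (simp_all add: z1_def complex_eq_iff power2_eq_square mult_ac)
  moreover have "(Re w)\<^sup>2 + (Im w)\<^sup>2 = Y"
    using wcw by (simp add: complex_eq_iff power2_eq_square)
  \<comment> \<open>(Im w)^2 = (Y - y) / 2, which leads to X^2 = pi s / 5. The Gaussian tail exp (-
    X^2 / 2) then lowers exp (pi s) to exp (9/10 pi s).\<close>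
  ultimately have Im2: "(Im w)\<^sup>2 = Y / 10" and ReIm: "2 * Re w * Im w = T" by (auto simp: y_def)
  have "Re w \<ge> 0" using Re_csqrt[of z1] by (simp add: w_def)
  have "Im w > 0"
  proof (rule ccontr)
    assume "\<not> Im w > 0"
    with \<open>Re w \<ge> 0\<close> have "Re w * Im w \<le> 0" by (intro mult_nonneg_nonpos) auto
    with ReIm T show False by simp
  qed
  then have X: "X \<ge> 0" using s by (simp add: X_def)
  have X2: "X\<^sup>2 = pi * s / 5"
  proof -
    have "X\<^sup>2 = 4 * s * s * (Y / 10)" by (simp add: X_def power_mult_distrib Im2) (simp add: power2_eq_square)
    also have "\<dots> = 4 * s * (s * Y) / 10" by simp
    finally show ?thesis unfolding Y(3) by simp
  qed
  obtain e where e: "((\<lambda>x::real. exp (- x\<^sup>2)) has_integral (sqrt pi - e)) {- X..X}"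
    "0 \<le> e" "e \<le> 3 * exp (- X\<^sup>2 / 2)"
    using gaussian_has_integral_truncated[OF X] by metis
  have G_diff: "G (\<i> * of_real X) - G (\<i> * of_real (- X)) = \<i> * of_real (sqrt pi - e)"
  proof -
    have "((\<lambda>x. \<i> * of_real (exp (- x\<^sup>2))) has_integral (G (\<i> * of_real X) - G (\<i> * of_real (- X)))) {- X..X}"
    proof (rule fundamental_theorem_of_calculus)
      fix x assume "x \<in> {- X..X}"
      have "((\<lambda>x. G (\<i> * x)) has_field_derivative exp ((\<i> * of_real x)\<^sup>2) * \<i>) (at (of_real x))"
        by (rule DERIV_chain2[OF G]) (auto intro!: derivative_eq_intros)
      then have "((\<lambda>x. G (\<i> * of_real x)) has_vector_derivative exp ((\<i> * of_real x)\<^sup>2) * \<i>) (at x)"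
        by (rule has_vector_derivative_real_field)
      moreover have "exp ((\<i> * complex_of_real x)\<^sup>2) * \<i> = \<i> * of_real (exp (- x\<^sup>2))"
        by (simp add: power_mult_distrib exp_of_real[symmetric])
      ultimately show "((\<lambda>x. G (\<i> * of_real x)) has_vector_derivative \<i> * of_real (exp (- x\<^sup>2))) (at x within {- X..X})"
        by (auto intro: has_vector_derivative_at_within)
    qed (use X in auto)
    moreover have "((\<lambda>x. \<i> * of_real (exp (- x\<^sup>2))) has_integral \<i> * of_real (sqrt pi - e)) {- X..X}"
      by (intro has_integral_mult_right has_integral_of_real e(1))
    ultimately show ?thesis by (rule has_integral_unique)
  qed
  \<comment> \<open>At the ends of the segment both summands of the exponent have real part 2/5 pi
    s, so the boundary terms are far below exp (pi s).\<close>
  have normE: "norm (E z) = exp (4 / 5 * pi * s)" if "Re z = y" "norm z = Y" for z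
  proof -
    have "Re (of_real (pi\<^sup>2 / 4) / z) = pi\<^sup>2 / 4 * (y / Y\<^sup>2)"
      unfolding Re_of_real_divide that ..
    also have "\<dots> = 2 / 5 * pi * s" using s by (simp add: y_def Y_def power2_eq_square field_simps)
    finally have 1: "Re (of_real (pi\<^sup>2 / 4) / z) = 2 / 5 * pi * s" .
    have "Re (of_real (s\<^sup>2) * z) = s\<^sup>2 * y" using that by simp
    also have "\<dots> = 2 / 5 * pi * s" using s by (simp add: y_def Y_def power2_eq_square)
    finally have 2: "Re (of_real (s\<^sup>2) * z) = 2 / 5 * pi * s" .
    show ?thesis unfolding E_def norm_exp_eq_Re plus_complex.sel(1) 1 2 by simp
  qed
  have nw: "norm w \<le> 1"
  proof -
    have "norm w = sqrt Y" unfolding w_def norm_csqrt z1 ..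
    then show ?thesis using Y by simp
  qed
  define R where "R = w * E z1 - cnj w * E (cnj z1)"
  have "\<Psi> z1 - \<Psi> (cnj z1) = (R + of_real c1 * (G (u z1) - G (u (cnj z1)))) / of_real (s\<^sup>2)"
    unfolding \<Psi>_def vX R_def w_cnj w_def[symmetric] by (simp add: diff_divide_distrib[symmetric] algebra_simps)
  also have "\<dots> = (R + of_real c1 * (\<i> * of_real (sqrt pi - e))) / of_real (s\<^sup>2)"
    unfolding uX G_diff ..
  finally have "I - of_real (c1 * sqrt pi / s\<^sup>2) = (R / \<i> - of_real (c1 * e)) / of_real (s\<^sup>2)"
  proof -
    assume D: "\<Psi> z1 - \<Psi> (cnj z1) = (R + of_real c1 * (\<i> * of_real (sqrt pi - e))) / of_real (s\<^sup>2)"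
    have "(a + c * (\<i> * q)) / S / \<i> = (a / \<i> + c * q) / S" for a c q S :: complex
    proof -
      have "c * (\<i> * q) = \<i> * (c * q)" by (rule mult.left_commute)
      then have "(a + c * (\<i> * q)) / \<i> = a / \<i> + c * q"
        by (simp only: add_divide_distrib nonzero_mult_div_cancel_left[OF complex_i_not_zero])
      moreover have "x / S / \<i> = x / \<i> / S" for x :: complex
        by (metis divide_divide_eq_left mult.commute)
      ultimately show ?thesis by (simp only:)
    qed
    then have "I = (R / \<i> + of_real c1 * of_real (sqrt pi - e)) / of_real (s\<^sup>2)"
      unfolding I_def D by blast
    moreover have "(r + c * (p - d)) / S - c * p / S = (r - c * d) / S" for r c p d S :: complex
      by (simp add: right_diff_distrib add_divide_distrib diff_divide_distrib)
    ultimately show ?thesis by (simp only: of_real_diff of_real_mult of_real_divide)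
  qed
  also have "norm \<dots> \<le> norm (R / \<i> - of_real (c1 * e)) / 1"
    unfolding norm_divide[of _ "of_real (s\<^sup>2)"] norm_of_real
    using s power_mono[of 1 s 2] by (intro divide_left_mono) auto
  also have "\<dots> \<le> norm R + \<bar>c1\<bar> * e"
    using norm_triangle_ineq4[of "R / \<i>" "of_real (c1 * e)"] e(2)
    by (simp add: norm_divide abs_mult norm_mult)
  also have "\<dots> \<le> 2 * exp (9 / 10 * pi * s) + 6 * exp (9 / 10 * pi * s)"
  proof (rule add_mono)
    have "norm R \<le> norm w * norm (E z1) + norm (cnj w) * norm (E (cnj z1))"
      unfolding R_def using norm_triangle_ineq4 norm_mult by metis
    also have "\<dots> = norm w * exp (4 / 5 * pi * s) + norm w * exp (4 / 5 * pi * s)"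
      using z1 by (simp add: normE z1_def)
    also have "\<dots> \<le> 1 * exp (4 / 5 * pi * s) + 1 * exp (4 / 5 * pi * s)"
      using nw by (intro add_mono mult_right_mono) auto
    also have "\<dots> \<le> 2 * exp (9 / 10 * pi * s)" using s by simp
    finally show "norm R \<le> 2 * exp (9 / 10 * pi * s)" .
    have c: "\<bar>pi / 2 - 1 / (2 * s)\<bar> \<le> 2"
    proof -
      have "0 < 1 / (2 * s)" "1 / (2 * s) \<le> 1" using s by auto
      then show ?thesis using pi_gt3 pi_less_4 by linarith
    qed
    have "\<bar>c1\<bar> * e \<le> (exp (pi * s) * 2) * (3 * exp (- X\<^sup>2 / 2))"
      unfolding c1_def abs_mult using e c by (intro mult_mono) auto
    also have "\<dots> = 6 * exp (9 / 10 * pi * s)"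
      unfolding X2 by (simp flip: exp_add)
    finally show "\<bar>c1\<bar> * e \<le> 6 * exp (9 / 10 * pi * s)" .
  qed
  finally have "norm (I - of_real (c1 * sqrt pi / s\<^sup>2)) \<le> 8 * exp (9 / 10 * pi * s)" by simp
  with int show ?thesis unfolding E_def y_def T_def c1_def by (rule that)
qed

text \<open>The circle \<open>|q| = exp (- y)\<close> with \<open>y = 2 * pi / (5 * s)\<close> lies slightly outside the saddle circle
  of radius \<open>exp (- pi / (2 * s))\<close>, chosen so that the points \<open>z\<close> of the segment \<open>Re z = y\<close> with
  \<open>|z| = pi / (2 * s)\<close> separate the major from the minor arc.\<close>

theorem overp_approx:
  fixes n :: nat
  assumes n: "n \<ge> 400"
  shows "\<bar>real (overp n) - exp (pi * sqrt n) / (8 * real n) * (1 - 1 / (pi * sqrt n))\<bar>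
           \<le> 10 * exp ((pi - 1 / 20) * sqrt n)"
proof -
  define s where "s = sqrt (real n)"
  have "20\<^sup>2 \<le> real n" using n by simp
  then have s: "s \<ge> 20" unfolding s_def by (rule real_le_rsqrt)
  have s2: "s\<^sup>2 = real n" by (simp add: s_def)
  define Y where "Y = pi / (2 * s)"
  define y where "y = 4 / 5 * Y"
  define T where "T = 3 / 5 * Y"
  define B where "B = exp ((pi - 1 / 20) * s)"
  have pi_le: "pi \<le> 3.2" using pi_approx by simp
  \<comment> \<open>With s >= 20 and pi <= 3.2, Y <= 3.2 / 40 <= 1/12. Hence y <= 1/15, which
    provides exp (- y) >= 14/15 for the minor arc.\<close>
  have Y: "0 < Y" "Y \<le> 1 / 12"
    using s pi_le by (auto simp: Y_def divide_le_eq)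
  have y: "0 < y" "y \<le> 1 / 15" using Y by (auto simp: y_def)
  have T: "0 < T" "T \<le> 1 / 20" "T \<le> pi" using Y pi_gt3 by (auto simp: T_def)
  have sy: "s\<^sup>2 * y = 2 / 5 * pi * s" using s by (simp add: y_def Y_def power2_eq_square)
  have ey: "exp (- y) \<ge> 14 / 15" using exp_ge_add_one_self[of "- y"] y by linarith
  let ?z = "\<lambda>t. Complex y t"
  define F where "F = (\<lambda>t. overp_gf (exp (- ?z t)) * exp (of_nat n * ?z t))"
  define M where "M = (\<lambda>t. csqrt (?z t) * exp (of_real (pi\<^sup>2 / 4) / ?z t + of_real (s\<^sup>2) * ?z t))"
  have F_int: "(F has_integral of_real (2 * pi * real (overp n))) {- pi..pi}"
    unfolding F_def by (rule overp_Cauchy_integral[OF y(1)])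
  have F_on: "F integrable_on {a..b}" for a b
    unfolding F_def Complex_eq
    by (intro integrable_continuous_real continuous_intros)
       (use overp_gf_exp_continuous[OF y(1)] in \<open>simp add: Complex_eq\<close>)
  have minor: "norm (F t) \<le> B" if "T \<le> \<bar>t\<bar>" "\<bar>t\<bar> \<le> pi" for t
  proof -
    have "norm (overp_gf (exp (- ?z t))) \<le> sqrt y * exp (pi\<^sup>2 / (4 * y) - 2 / (11 * y))"
      by (rule overp_gf_minor_arc) (use that y ey in \<open>auto simp: T_def y_def\<close>)
    also have "\<dots> \<le> 1 * exp (pi\<^sup>2 / (4 * y) - 2 / (11 * y))" using y by (intro mult_right_mono) auto
    finally have "norm (F t) \<le> exp (pi\<^sup>2 / (4 * y) - 2 / (11 * y)) * exp (s\<^sup>2 * y)"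
      unfolding F_def norm_mult s2 by (intro mult_mono) auto
    also have "\<dots> = exp (pi\<^sup>2 / (4 * y) - 2 / (11 * y) + s\<^sup>2 * y)" by (simp add: exp_add)
    also have "\<dots> \<le> B"
      unfolding B_def exp_le_cancel_iff
    proof -
      have 1: "pi\<^sup>2 / (4 * y) = 5 / 8 * pi * s" using s by (simp add: y_def Y_def power2_eq_square)
      have 2: "2 / (11 * y) = 5 / (11 * pi) * s" using s by (simp add: y_def Y_def)
      \<comment> \<open>Leaving the saddle radius costs (5/8 + 2/5) pi - pi = pi / 40, at most 0.08;
        the saving 5 / (11 pi) is at least 0.14, so a net gain of 1/20 remains.\<close>
      have "5 / (11 * 3.2) \<le> 5 / (11 * pi)" using pi_le by (intro divide_left_mono) auto
      then have "1 / 40 * pi - 5 / (11 * pi) \<le> - 1 / 20" using pi_le by simp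
      then have "(1 / 40 * pi - 5 / (11 * pi)) * s \<le> (- 1 / 20) * s" using s by (intro mult_right_mono) auto
      then show "pi\<^sup>2 / (4 * y) - 2 / (11 * y) + s\<^sup>2 * y \<le> (pi - 1 / 20) * s"
        unfolding 1 2 sy by (simp add: algebra_simps)
    qed
    finally show ?thesis .
  qed
  have major: "norm (F t - M t / of_real (2 * sqrt pi)) \<le> 2 * B" if t: "\<bar>t\<bar> \<le> T" for t
  proof -
    \<comment> \<open>The whole segment lies in the disc |z| <= Y. This keeps Re (1 / z) at least y
      / Y^2, which makes |Q| small enough for \<open>overp_gf_near_1\<close>.\<close>
    have "(norm (?z t))\<^sup>2 \<le> y\<^sup>2 + T\<^sup>2"
      using t unfolding cmod_power2 by (simp add: abs_le_square_iff[symmetric])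
    also have "\<dots> = Y\<^sup>2" by (simp add: y_def T_def power2_eq_square)
    finally have z2: "(norm (?z t))\<^sup>2 \<le> Y\<^sup>2" .
    then have z1: "norm (?z t) \<le> 1" using Y by (intro order_trans[OF power2_le_imp_le[OF z2]]) auto
    have z0: "?z t \<noteq> 0" using y by (auto simp: complex_eq_iff)
    have "2 / 5 * pi * s = pi\<^sup>2 / 4 * (y / Y\<^sup>2)" using s by (simp add: y_def Y_def power2_eq_square field_simps)
    also have "\<dots> \<le> pi\<^sup>2 / 4 * (y / (norm (?z t))\<^sup>2)"
      using z2 y z0 Y by (intro mult_left_mono divide_left_mono) auto
    also have "\<dots> = Re (of_real (pi\<^sup>2 / 4) / ?z t)"
      unfolding Re_of_real_divide by simp
    finally have Re_ge: "2 / 5 * pi * s \<le> Re (of_real (pi\<^sup>2 / 4) / ?z t)" .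
    have "3 \<le> 2 / 5 * pi * s"
    proof -
      have "3 * 20 \<le> pi * s" using pi_gt3 s by (intro mult_mono) auto
      then show ?thesis by simp
    qed
    then have "3 \<le> Re (of_real (pi\<^sup>2 / 4) / ?z t)" using Re_ge by linarith
    then have "norm (exp (- of_real (pi\<^sup>2 / 4) / ?z t)) \<le> exp (- 3)" by simp
    also have "exp (- 3) \<le> (1 / 4 :: real)"
      using exp_ge_add_one_self[of "3 :: real"] by (simp add: exp_minus field_simps)
    finally have "norm (overp_gf (exp (- ?z t)) - csqrt (?z t) * exp (of_real (pi\<^sup>2 / 4) / ?z t) / of_real (2 * sqrt pi))
           \<le> 2 * sqrt (norm (?z t))"
      by (intro overp_gf_near_1) (use y in auto)
    also have "\<dots> \<le> 2 * 1" using z1 by (intro mult_left_mono) auto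
    finally have 1: "norm (overp_gf (exp (- ?z t)) - csqrt (?z t) * exp (of_real (pi\<^sup>2 / 4) / ?z t) / of_real (2 * sqrt pi)) \<le> 2" by simp
    have "F t - M t / of_real (2 * sqrt pi) =
      (overp_gf (exp (- ?z t)) - csqrt (?z t) * exp (of_real (pi\<^sup>2 / 4) / ?z t) / of_real (2 * sqrt pi)) * exp (of_nat n * ?z t)"
      unfolding F_def M_def s2 exp_add by (simp add: left_diff_distrib)
    then have "norm (F t - M t / of_real (2 * sqrt pi)) \<le> 2 * norm (exp (of_nat n * ?z t))"
      using 1 by (simp add: norm_mult mult_right_mono)
    also have "norm (exp (of_nat n * ?z t)) = exp (s\<^sup>2 * y)" by (simp add: s2)
    also have "exp (s\<^sup>2 * y) \<le> B"
      unfolding B_def sy exp_le_cancel_iff using s pi_gt3 by (intro mult_right_mono) auto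
    finally show ?thesis by simp
  qed
  obtain I where I: "(M has_integral I) {- T..T}"
    "norm (I - of_real (exp (pi * s) * (pi / 2 - 1 / (2 * s)) * sqrt pi / s\<^sup>2)) \<le> 8 * exp (9 / 10 * pi * s)"
    using saddle_integral[of s] s unfolding M_def y_def T_def Y_def by auto
  have I_B: "norm (I - of_real (exp (pi * s) * (pi / 2 - 1 / (2 * s)) * sqrt pi / s\<^sup>2)) \<le> 8 * B"
  proof -
    have "9 / 10 * pi * s \<le> (pi - 1 / 20) * s" using s pi_gt3 by (intro mult_right_mono) auto
    then show ?thesis using I(2) unfolding B_def by (smt (verit) exp_le_cancel_iff)
  qed
  have B0: "B \<ge> 0" by (simp add: B_def)
  have b1: "norm (integral {- pi..- T} F) \<le> B * pi"
  proof -
    have "norm (integral {- pi..- T} F) \<le> B * measure lborel {- pi..- T}"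
      by (rule has_integral_bound_real[OF B0 finite.emptyI integrable_integral[OF F_on]])
         (use minor T in auto)
    also have "\<dots> \<le> B * pi" using B0 T by (intro mult_left_mono) auto
    finally show ?thesis .
  qed
  have b2: "norm (integral {T..pi} F) \<le> B * pi"
  proof -
    have "norm (integral {T..pi} F) \<le> B * measure lborel {T..pi}"
      by (rule has_integral_bound_real[OF B0 finite.emptyI integrable_integral[OF F_on]])
         (use minor T in auto)
    also have "\<dots> \<le> B * pi" using B0 T by (intro mult_left_mono) auto
    finally show ?thesis .
  qed
  have b3: "norm (integral {- T..T} F - I / of_real (2 * sqrt pi)) \<le> B"
  proof -
    have "norm (integral {- T..T} F - I / of_real (2 * sqrt pi)) \<le> (2 * B) * measure lborel {- T..T}"
    proof (rule has_integral_bound_real[of _ "{}"])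
      show "((\<lambda>t. F t - M t / of_real (2 * sqrt pi)) has_integral
              integral {- T..T} F - I / of_real (2 * sqrt pi)) {- T..T}"
        by (intro has_integral_diff integrable_integral[OF F_on] has_integral_divide I(1))
    qed (use major B0 in auto)
    also have "\<dots> = B * (4 * T)" using T by simp
    also have "\<dots> \<le> B * 1" using B0 T by (intro mult_left_mono) auto
    finally show ?thesis by simp
  qed
  have split: "of_real (2 * pi * real (overp n)) = integral {- pi..- T} F + integral {- T..T} F + integral {T..pi} F"
  proof -
    have "integral {- pi..pi} F = integral {- pi..- T} F + integral {- T..pi} F"
      by (rule Henstock_Kurzweil_Integration.integral_combine[symmetric]) (use T F_on in auto)
    also have "integral {- T..pi} F = integral {- T..T} F + integral {T..pi} F"
      by (rule Henstock_Kurzweil_Integration.integral_combine[symmetric]) (use T F_on in auto)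
    finally show ?thesis using integral_unique[OF F_int] by (simp add: add.assoc)
  qed
  define m where "m = exp (pi * s) * (pi / 2 - 1 / (2 * s)) * sqrt pi / s\<^sup>2"
  have b4: "norm ((I - of_real m) / of_real (2 * sqrt pi)) \<le> 8 * B / 2"
  proof -
    have "1 \<le> sqrt pi" using pi_gt3 by simp
    then show ?thesis
      unfolding norm_divide using I_B unfolding m_def
      by (intro frac_le) (use B0 in auto)
  qed
  \<comment> \<open>The four errors: two minor arcs with B pi each, the theta remainder on the major
    arc with B, and the saddle integral with 4 B.\<close>
  have "complex_of_real (2 * pi * real (overp n) - m / (2 * sqrt pi)) =
      integral {- pi..- T} F + integral {T..pi} F
      + (integral {- T..T} F - I / of_real (2 * sqrt pi)) + (I - of_real m) / of_real (2 * sqrt pi)"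
    unfolding of_real_diff split by (simp add: diff_divide_distrib)
  then have "norm (complex_of_real (2 * pi * real (overp n) - m / (2 * sqrt pi))) \<le> B * pi + B * pi + B + 8 * B / 2"
    using b1 b2 b3 b4 by (simp only:) (intro norm_triangle_le add_mono; assumption)
  then have "\<bar>2 * pi * real (overp n) - m / (2 * sqrt pi)\<bar> \<le> 2 * pi * B + 5 * B"
    unfolding norm_of_real by (simp add: algebra_simps)
  also have "\<dots> \<le> 2 * pi * (10 * B)"
  proof -
    have "5 * B \<le> (18 * pi) * B" using B0 pi_gt3 by (intro mult_right_mono) auto
    then show ?thesis by (simp add: algebra_simps)
  qed
  finally have "\<bar>2 * pi * real (overp n) - m / (2 * sqrt pi)\<bar> \<le> 2 * pi * (10 * B)" .
  \<comment> \<open>pi / 2 - 1 / (2 s) = pi / 2 * (1 - 1 / (pi s)) is the origin of the correction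
    factor.\<close>
  moreover have "m / (2 * sqrt pi) = 2 * pi * (exp (pi * s) / (8 * real n) * (1 - 1 / (pi * s)))"
    using s by (simp add: m_def s2[symmetric] field_simps power2_eq_square)
  ultimately have "\<bar>2 * pi * (real (overp n) - exp (pi * s) / (8 * real n) * (1 - 1 / (pi * s)))\<bar> \<le> 2 * pi * (10 * B)"
    by (simp only: right_diff_distrib)
  then have "2 * pi * \<bar>real (overp n) - exp (pi * s) / (8 * real n) * (1 - 1 / (pi * s))\<bar> \<le> 2 * pi * (10 * B)"
    unfolding abs_mult[of "2 * pi"] by simp
  then have "\<bar>real (overp n) - exp (pi * s) / (8 * real n) * (1 - 1 / (pi * s))\<bar> \<le> 10 * B"
    by (rule mult_left_le_imp_le) simp
  then show ?thesis by (simp add: B_def s_def)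
qed

section \<open>Iterated differences\<close>

lemma fwd_diff_iter_linear:
  fixes f g :: "nat \<Rightarrow> real"
  shows "(fwd_diff ^^ r) (\<lambda>n. f n + g n) = (\<lambda>n. (fwd_diff ^^ r) f n + (fwd_diff ^^ r) g n)"
    and "(fwd_diff ^^ r) (\<lambda>n. c * f n) = (\<lambda>n. c * (fwd_diff ^^ r) f n)"
  by (induction r) (auto simp: fwd_diff_def fun_eq_iff algebra_simps)

lemma fwd_diff_iter_sum:
  fixes f :: "'i \<Rightarrow> nat \<Rightarrow> real"
  shows "(fwd_diff ^^ r) (\<lambda>n. \<Sum>i\<in>A. f i n) = (\<lambda>n. \<Sum>i\<in>A. (fwd_diff ^^ r) (f i) n)"
  by (induction r) (auto simp: fwd_diff_def fun_eq_iff sum_subtractf)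

text \<open>Induction on \<open>r\<close>: the hypothesis applies to the functions \<open>D i (x + 1) - D i x\<close>, and the mean
  value theorem turns the resulting \<open>D r (\<xi> + 1) - D r \<xi>\<close> into a value of \<open>D (r + 1)\<close>.\<close>

lemma fwd_diff_iter_eq_deriv:
  fixes D :: "nat \<Rightarrow> real \<Rightarrow> real"
  assumes "\<And>i x. x > 0 \<Longrightarrow> (D i has_real_derivative D (Suc i) x) (at x)" and "n > 0"
  shows "\<exists>\<xi>. real n \<le> \<xi> \<and> \<xi> \<le> real (n + r) \<and> (fwd_diff ^^ r) (\<lambda>m. D 0 (real m)) n = D r \<xi>"
  using assms
proof (induction r arbitrary: D)
  case (Suc r)
  define E where "E = (\<lambda>i x. D i (x + 1) - D i x)"
  have "(E i has_real_derivative E (Suc i) x) (at x)" if "x > 0" for i x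
    unfolding E_def using that
    by (auto intro!: derivative_eq_intros Suc.prems(1) DERIV_chain'[OF _ Suc.prems(1), of "\<lambda>x. x + 1" 1, simplified])
  from Suc.IH[of E, OF this] Suc.prems(2) obtain \<xi> where
    \<xi>: "real n \<le> \<xi>" "\<xi> \<le> real (n + r)" "(fwd_diff ^^ r) (\<lambda>m. E 0 (real m)) n = E r \<xi>" by auto
  have "fwd_diff (\<lambda>m. D 0 (real m)) = (\<lambda>m. E 0 (real m))"
    by (auto simp: fwd_diff_def E_def add.commute)
  then have eq: "(fwd_diff ^^ Suc r) (\<lambda>m. D 0 (real m)) n = E r \<xi>"
    using \<xi> by (simp only: funpow_Suc_right o_apply)
  have "\<exists>z. \<xi> < z \<and> z < \<xi> + 1 \<and> D r (\<xi> + 1) - D r \<xi> = (\<xi> + 1 - \<xi>) * D (Suc r) z"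
    by (rule MVT2) (use \<xi> Suc.prems in auto)
  then obtain z where "\<xi> < z" "z < \<xi> + 1" "E r \<xi> = D (Suc r) z" by (auto simp: E_def)
  with \<xi> eq show ?case by (intro exI[of _ z]) auto
qed auto

text \<open>The intermediate point lies in [n, n + r], so its ratio to \<open>n\<close> tends to 1
  and the decay of the derivative passes to the difference.\<close>

lemma fwd_diff_iter_tendsto:
  fixes D :: "nat \<Rightarrow> real \<Rightarrow> real"
  assumes D: "\<And>i x. x > 0 \<Longrightarrow> (D i has_real_derivative D (Suc i) x) (at x)"
    and L: "((\<lambda>x. x powr s * D r x) \<longlongrightarrow> L) at_top"
  shows "(\<lambda>n. real n powr s * (fwd_diff ^^ r) (\<lambda>m. D 0 (real m)) n) \<longlonglongrightarrow> L"
proof -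
  have "\<forall>n\<in>{0<..}. \<exists>\<xi>. real n \<le> \<xi> \<and> \<xi> \<le> real (n + r) \<and>
          (fwd_diff ^^ r) (\<lambda>m. D 0 (real m)) n = D r \<xi>"
    using fwd_diff_iter_eq_deriv[of D _ r] D by auto
  then obtain \<xi> where \<xi>: "\<And>n. n > 0 \<Longrightarrow> real n \<le> \<xi> n" "\<And>n. n > 0 \<Longrightarrow> \<xi> n \<le> real (n + r)"
     "\<And>n. n > 0 \<Longrightarrow> (fwd_diff ^^ r) (\<lambda>m. D 0 (real m)) n = D r (\<xi> n)"
    by (metis greaterThan_iff)
  have pos: "\<forall>\<^sub>F n in sequentially. n > (0::nat)" by (rule eventually_gt_at_top)
  have \<xi>_top: "filterlim \<xi> at_top sequentially"
    by (rule filterlim_at_top_mono[OF filterlim_real_sequentially])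
       (use pos in eventually_elim, rule \<xi>)
  have "(\<lambda>n. \<xi> n / real n) \<longlonglongrightarrow> 1"
  proof (rule tendsto_sandwich[of "\<lambda>_. 1" _ _ "\<lambda>n. (real n + real r) / real n"])
    show "(\<lambda>n. (real n + real r) / real n) \<longlonglongrightarrow> 1" by real_asymp
    show "\<forall>\<^sub>F n in sequentially. 1 \<le> \<xi> n / real n"
      using pos by eventually_elim (use \<xi> in \<open>simp add: field_simps\<close>)
    show "\<forall>\<^sub>F n in sequentially. \<xi> n / real n \<le> (real n + real r) / real n"
      using pos by eventually_elim (use \<xi> in \<open>simp add: divide_right_mono\<close>)
  qed simp
  then have "(\<lambda>n. (\<xi> n / real n) powr (- s) * (\<xi> n powr s * D r (\<xi> n))) \<longlonglongrightarrow> 1 powr (- s) * L"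
    using L \<xi>_top by (intro tendsto_intros filterlim_compose[OF L]) auto
  moreover have "\<forall>\<^sub>F n in sequentially. (\<xi> n / real n) powr (- s) * (\<xi> n powr s * D r (\<xi> n)) =
      real n powr s * (fwd_diff ^^ r) (\<lambda>m. D 0 (real m)) n"
    using pos
  proof eventually_elim
    case (elim n)
    then have "\<xi> n > 0" using \<xi>(1)[of n] by linarith
    with elim show ?case by (simp add: \<xi> powr_divide powr_minus field_simps)
  qed
  ultimately show ?thesis using tendsto_cong by force
qed

lemma fwd_diff_iter_powr_tendsto:
  "(\<lambda>n. real n powr (real r - s) * (fwd_diff ^^ r) (\<lambda>m. real m powr s) n)
     \<longlonglongrightarrow> (\<Prod>i<r. s - real i)"
proof -
  define D where "D = (\<lambda>i x. (\<Prod>j<i. s - real j) * x powr (s - real i))"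
  have D: "(D i has_real_derivative D (Suc i) x) (at x)" if "x > 0" for i x
    using that unfolding D_def
    by (auto intro!: derivative_eq_intros simp: algebra_simps)
  have "\<forall>\<^sub>F x in at_top. x powr (real r - s) * D r x = (\<Prod>i<r. s - real i)"
    using eventually_gt_at_top[of 0]
    by eventually_elim (simp add: D_def powr_add[symmetric] mult.left_commute)
  then have "((\<lambda>x. x powr (real r - s) * D r x) \<longlongrightarrow> (\<Prod>i<r. s - real i)) at_top"
    by (rule tendsto_eventually)
  from fwd_diff_iter_tendsto[of D, OF D this] show ?thesis by (simp add: D_def)
qed

lemma fwd_diff_iter_ln_tendsto_0:
  assumes "r \<ge> 1"
  shows "(\<lambda>n. real n powr (real r - 1 / 2) * (fwd_diff ^^ r) (\<lambda>m. ln (real m)) n) \<longlonglongrightarrow> 0"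
proof -
  \<comment> \<open>For i >= 1 this is the derivative of order i - 1 of 1 / x.\<close>
  define D where "D = (\<lambda>i x. if i = 0 then ln x else (\<Prod>j<i - 1. - 1 - real j) * x powr (- real i))"
  have D: "(D i has_real_derivative D (Suc i) x) (at x)" if "x > 0" for i x
  proof (cases i)
    case 0
    then show ?thesis using that
      by (auto intro!: derivative_eq_intros simp: D_def powr_minus inverse_eq_divide)
  next
    case (Suc k)
    then show ?thesis using that
      by (auto intro!: derivative_eq_intros simp: D_def algebra_simps)
  qed
  have "((\<lambda>x. (\<Prod>j<r - 1. - 1 - real j) * x powr (- (1 / 2))) \<longlongrightarrow> (\<Prod>j<r - 1. - 1 - real j) * 0) at_top"
    by (intro tendsto_intros) real_asymp
  moreover have "\<forall>\<^sub>F x in at_top. (\<Prod>j<r - 1. - 1 - real j) * x powr (- (1 / 2)) = x powr (real r - 1 / 2) * D r x"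
    using eventually_gt_at_top[of 0]
    by eventually_elim (use assms in \<open>simp add: D_def powr_add[symmetric] mult.left_commute\<close>)
  ultimately have "((\<lambda>x. x powr (real r - 1 / 2) * D r x) \<longlongrightarrow> 0) at_top"
    by (simp add: tendsto_cong)
  from fwd_diff_iter_tendsto[of D, OF D this] show ?thesis by (simp add: D_def)
qed

text \<open>For remainders without known regularity: differencing gains nothing here but loses
  nothing either, so they must be small enough beforehand.\<close>

lemma fwd_diff_iter_small:
  fixes f :: "nat \<Rightarrow> real"
  assumes "(\<lambda>n. real n powr s * f n) \<longlonglongrightarrow> 0"
  shows "(\<lambda>n. real n powr s * (fwd_diff ^^ r) f n) \<longlonglongrightarrow> 0"
  using assms
proof (induction r)
  case (Suc r)
  let ?g = "(fwd_diff ^^ r) f"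
  have "(\<lambda>n. real (n + 1) powr s * ?g (n + 1)) \<longlonglongrightarrow> 0"
    using LIMSEQ_ignore_initial_segment[OF Suc.IH[OF Suc.prems], of 1] by simp
  moreover have "(\<lambda>n. (real n / real (n + 1)) powr s) \<longlonglongrightarrow> 1 powr s"
    by (intro tendsto_powr tendsto_const) (real_asymp, simp)
  ultimately have "(\<lambda>n. (real n / real (n + 1)) powr s * (real (n + 1) powr s * ?g (n + 1)) - real n powr s * ?g n)
      \<longlonglongrightarrow> 1 powr s * 0 - 0"
    by (intro tendsto_diff tendsto_mult Suc.IH Suc.prems)
  moreover have "(real n / real (n + 1)) powr s * (real (n + 1) powr s * ?g (n + 1)) - real n powr s * ?g n
       = real n powr s * (fwd_diff ^^ Suc r) f n" for n
    by (simp add: fwd_diff_def powr_divide right_diff_distrib)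
  ultimately show ?case by simp
qed auto

lemma prod_half_minus_eq_pochhammer:
  assumes "r \<ge> 1"
  shows "(\<Prod>i<r. 1 / 2 - real i) = 1 / 2 * (-1) ^ (r - 1) * pochhammer (1 / 2) (r - 1)"
proof -
  obtain k where r: "r = Suc k" using assms by (cases r) auto
  have "(\<Prod>i<Suc k. 1 / 2 - real i) = 1 / 2 * (-1) ^ k * pochhammer (1 / 2) k"
  proof (induction k)
    case (Suc k)
    have "(\<Prod>i<Suc (Suc k). 1 / 2 - real i) = 1 / 2 * (-1) ^ k * pochhammer (1 / 2) k * (1 / 2 - real (Suc k))"
      unfolding prod.lessThan_Suc[of _ "Suc k"] Suc ..
    also have "\<dots> = 1 / 2 * (-1) ^ Suc k * pochhammer (1 / 2) (Suc k)"
      by (simp add: pochhammer_Suc field_simps)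
    finally show ?case .
  qed simp
  then show ?thesis by (simp add: r)
qed

section \<open>Logarithmic asymptotics\<close>

lemma overp_ratio_tendsto:
  fixes k :: nat
  shows "(\<lambda>n. real n ^ k * (real (overp n) / (exp (pi * sqrt n) / (8 * real n) * (1 - 1 / (pi * sqrt n))) - 1)) \<longlonglongrightarrow> 0"
proof (rule Lim_null_comparison)
  let ?M = "\<lambda>n::nat. exp (pi * sqrt n) / (8 * real n) * (1 - 1 / (pi * sqrt n))"
  \<comment> \<open>160 = 10 * 8 * 2: the constant of \<open>overp_approx\<close>, the denominator
    of the main term, and 2 from 1 - 1 / (pi sqrt n) >= 1/2.\<close>
  show "\<forall>\<^sub>F n in sequentially. norm (real n ^ k * (real (overp n) / ?M n - 1)) \<le>
      real n ^ k * (160 * real n * exp (- (1 / 20) * sqrt n))"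
    using eventually_ge_at_top[of 400]
  proof eventually_elim
    case (elim n)
    have "20\<^sup>2 \<le> real n" using elim by simp
    then have s: "sqrt n \<ge> 20" by (rule real_le_rsqrt)
    have "3 * 20 \<le> pi * sqrt n" using pi_gt3 s by (intro mult_mono) auto
    then have half: "1 / 2 \<le> 1 - 1 / (pi * sqrt n)" by (simp add: field_simps)
    define m where "m = exp (pi * sqrt n) / (8 * real n) * (1 - 1 / (pi * sqrt n))"
    have m: "m \<ge> exp (pi * sqrt n) / (8 * real n) * (1 / 2)"
      unfolding m_def by (intro mult_left_mono half) auto
    have m0: "exp (pi * sqrt n) / (8 * real n) * (1 / 2) > 0" using elim by simp
    have "\<bar>real (overp n) / m - 1\<bar> = \<bar>real (overp n) - m\<bar> / m"
      using m m0 by (simp add: field_simps abs_divide)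
    also have "\<dots> \<le> (10 * exp ((pi - 1 / 20) * sqrt n)) / (exp (pi * sqrt n) / (8 * real n) * (1 / 2))"
      using overp_approx[OF elim] m m0 unfolding m_def[symmetric] by (intro frac_le) auto
    also have "\<dots> = 160 * real n * (exp ((pi - 1 / 20) * sqrt n) / exp (pi * sqrt n))"
      using elim by (simp add: field_simps)
    also have "exp ((pi - 1 / 20) * sqrt n) / exp (pi * sqrt n) = exp (- (1 / 20) * sqrt n)"
      unfolding exp_diff[symmetric] by (simp add: left_diff_distrib)
    finally show ?case unfolding m_def[symmetric] by (simp add: abs_mult mult_left_mono)
  qed
  show "(\<lambda>n. real n ^ k * (160 * real n * exp (- (1 / 20) * sqrt n))) \<longlonglongrightarrow> 0"
    by real_asymp
qed

text \<open>The finite geometric sum collapses the derivative to - z^J / (1 - z), so one use of the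
  mean value theorem suffices; the factor 2 is from 1 - z >= 1/2.\<close>

lemma ln_one_minus_truncated:
  fixes x :: real assumes x: "0 < x" "x \<le> 1 / 2"
  shows "\<bar>ln (1 - x) + (\<Sum>j=1..J. x ^ j / real j)\<bar> \<le> 2 * x ^ Suc J"
proof -
  let ?L = "\<lambda>x::real. ln (1 - x) + (\<Sum>j=1..J. x ^ j / real j)"
  have "\<exists>z. 0 < z \<and> z < x \<and> ?L x - ?L 0 = (x - 0) * (- (z ^ J) / (1 - z))"
  proof (rule MVT2[OF x(1)])
    fix z :: real assume z: "0 \<le> z" "z \<le> x"
    have "(?L has_real_derivative - 1 / (1 - z) + (\<Sum>j=1..J. real j * z ^ (j - 1) / real j)) (at z)"
      using z x by (auto intro!: derivative_eq_intros DERIV_sum simp: field_simps)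
    also have "(\<Sum>j=1..J. real j * z ^ (j - 1) / real j) = (\<Sum>i<J. z ^ i)"
      by (rule sum.reindex_bij_witness[of _ Suc "\<lambda>j. j - 1"]) auto
    also have "- 1 / (1 - z) + (\<Sum>i<J. z ^ i) = - (z ^ J) / (1 - z)"
      using z x by (simp add: sum_gp_strict flip: diff_divide_distrib)
    finally show "(?L has_real_derivative - (z ^ J) / (1 - z)) (at z)" .
  qed
  then obtain z where z: "0 < z" "z < x" "?L x - ?L 0 = (x - 0) * (- (z ^ J) / (1 - z))" by blast
  have "(\<Sum>j=1..J. 0 ^ j / real j) = (0 :: real)" by (intro sum.neutral) auto
  then have "\<bar>?L x\<bar> = x * (z ^ J / (1 - z))" using z x by (simp add: abs_mult abs_divide power_abs)
  also have "\<dots> \<le> x * (x ^ J / (1 / 2))"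
    using z x by (intro mult_left_mono frac_le power_mono) auto
  finally show ?thesis by simp
qed

text \<open>The remainder has two sources: the exponentially small error of the ratio, and
  truncating ln (1 - x) at x = 1 / (pi sqrt n), which costs o(x^J). As \<open>J\<close> is free, any
  power of \<open>n\<close> can be reached.\<close>

lemma ln_overp_expansion:
  fixes J :: nat
  defines "R \<equiv> (\<lambda>n. ln (real (overp n)) - (pi * sqrt n - ln 8 - ln (real n)
                   - (\<Sum>j=1..J. 1 / (real j * pi ^ j) * real n powr (- real j / 2))))"
  shows "(\<lambda>n. real n powr (real J / 2) * R n) \<longlonglongrightarrow> 0"
proof -
  define \<epsilon> where "\<epsilon> = (\<lambda>n::nat. real (overp n) / (exp (pi * sqrt n) / (8 * real n) * (1 - 1 / (pi * sqrt n))) - 1)"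
  define L where "L = (\<lambda>x::real. ln (1 - x) + (\<Sum>j=1..J. x ^ j / real j))"
  have \<epsilon>: "(\<lambda>n. real n ^ J * \<epsilon> n) \<longlonglongrightarrow> 0" for J
    unfolding \<epsilon>_def by (rule overp_ratio_tendsto)
  have \<epsilon>0: "\<epsilon> \<longlonglongrightarrow> 0" using \<epsilon>[of 0] by simp
  have R_eq: "\<forall>\<^sub>F n in sequentially. R n = ln (1 + \<epsilon> n) + L (1 / (pi * sqrt n))"
    using eventually_ge_at_top[of 1]
  proof eventually_elim
    case (elim n)
    have s: "sqrt n \<ge> 1" using elim by simp
    have "3 * 1 \<le> pi * sqrt n" using pi_gt3 s by (intro mult_mono) auto
    then have pos: "0 < 1 - 1 / (pi * sqrt n)" by (simp add: field_simps)
    have "real (overp n) = (1 + \<epsilon> n) * (exp (pi * sqrt n) / (8 * real n) * (1 - 1 / (pi * sqrt n)))"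
      using elim pos by (simp add: \<epsilon>_def)
    moreover have "1 + \<epsilon> n > 0" using elim pos overp_pos[of n] by (simp add: \<epsilon>_def)
    ultimately have "ln (real (overp n)) = ln (1 + \<epsilon> n) + (pi * sqrt n - (ln 8 + ln (real n)) + ln (1 - 1 / (pi * sqrt n)))"
      using elim pos by (simp add: ln_mult_pos ln_div)
    moreover have "(1 / (pi * sqrt n)) ^ j / real j = 1 / (real j * pi ^ j) * real n powr (- real j / 2)" for j
    proof -
      have "sqrt (real n) ^ j = real n powr (real j / 2)"
        using elim by (simp add: powr_half_sqrt[symmetric] powr_powr flip: powr_realpow)
      moreover have "real n powr (- real j / 2) = 1 / real n powr (real j / 2)"
        using powr_minus_divide[of "real n" "real j / 2"] by simp
      moreover have "(1 / (a * b)) ^ j / c = 1 / (c * a ^ j) * (1 / b ^ j)" for a b c :: real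
        by (simp add: power_divide power_mult_distrib)
      ultimately show ?thesis by (simp only:)
    qed
    ultimately show ?case unfolding R_def L_def by simp
  qed
  have "(\<lambda>n. real n powr (real J / 2) * ln (1 + \<epsilon> n)) \<longlonglongrightarrow> 0"
  proof (rule Lim_null_comparison)
    have "\<forall>\<^sub>F n in sequentially. \<bar>\<epsilon> n\<bar> < 1 / 2"
      using \<epsilon>0 by (auto simp: tendsto_iff dist_real_def dest: spec[of _ "1/2"])
    then show "\<forall>\<^sub>F n in sequentially. norm (real n powr (real J / 2) * ln (1 + \<epsilon> n)) \<le> 2 * \<bar>real n ^ J * \<epsilon> n\<bar>"
      using eventually_ge_at_top[of 1]
    proof eventually_elim
      case (elim n)
      have "real n powr (real J / 2) \<le> real n powr real J" using elim by (intro powr_mono) auto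
      then have 1: "real n powr (real J / 2) \<le> real n ^ J" using elim by (simp add: powr_realpow)
      have "\<bar>ln (1 + \<epsilon> n) - \<epsilon> n\<bar> \<le> 2 * (\<epsilon> n)\<^sup>2" using elim by (intro abs_ln_one_plus_x_minus_x_bound) auto
      moreover have "2 * (\<epsilon> n)\<^sup>2 \<le> \<bar>\<epsilon> n\<bar>"
      proof -
        have "\<bar>\<epsilon> n\<bar> * \<bar>\<epsilon> n\<bar> \<le> \<bar>\<epsilon> n\<bar> * (1 / 2)" using elim by (intro mult_left_mono) auto
        then show ?thesis by (simp add: power2_eq_square flip: abs_mult)
      qed
      ultimately have "\<bar>ln (1 + \<epsilon> n)\<bar> \<le> 2 * \<bar>\<epsilon> n\<bar>" by linarith
      then have "real n powr (real J / 2) * \<bar>ln (1 + \<epsilon> n)\<bar> \<le> real n ^ J * (2 * \<bar>\<epsilon> n\<bar>)"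
        using 1 by (intro mult_mono) auto
      then show ?case by (simp add: abs_mult mult_ac)
    qed
    show "(\<lambda>n. 2 * \<bar>real n ^ J * \<epsilon> n\<bar>) \<longlonglongrightarrow> 0"
      using tendsto_mult_left[OF tendsto_rabs_zero[OF \<epsilon>[of J]], of 2] by simp
  qed
  moreover have "(\<lambda>n. real n powr (real J / 2) * L (1 / (pi * sqrt n))) \<longlonglongrightarrow> 0"
  proof -
    have lim: "((\<lambda>x. L x / x ^ J) \<longlongrightarrow> 0) (at_right 0)"
    proof (rule Lim_null_comparison)
      have "\<forall>\<^sub>F x in at_right 0. x \<in> {0<..<1 / 2 :: real}" by (rule eventually_at_right_real) simp
      then show "\<forall>\<^sub>F x in at_right 0. norm (L x / x ^ J) \<le> 2 * x"
      proof eventually_elim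
        case (elim x)
        then have "\<bar>L x\<bar> \<le> 2 * x * x ^ J" using ln_one_minus_truncated[of x J] by (simp add: L_def)
        then show ?case using elim by (simp add: abs_divide power_abs divide_le_eq)
      qed
      show "((\<lambda>x::real. 2 * x) \<longlongrightarrow> 0) (at_right 0)" by (auto intro!: tendsto_eq_intros)
    qed
    have "filterlim (\<lambda>n::nat. 1 / (pi * sqrt n)) (at_right 0) sequentially" by real_asymp
    from filterlim_compose[OF lim this]
    have "(\<lambda>n. (1 / pi) ^ J * (L (1 / (pi * sqrt n)) / (1 / (pi * sqrt n)) ^ J)) \<longlonglongrightarrow> (1 / pi) ^ J * 0"
      by (rule tendsto_mult_left)
    moreover have "\<forall>\<^sub>F n in sequentially. (1 / pi) ^ J * (L (1 / (pi * sqrt n)) / (1 / (pi * sqrt n)) ^ J) =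
        real n powr (real J / 2) * L (1 / (pi * sqrt n))"
      using eventually_gt_at_top[of 0]
    proof eventually_elim
      case (elim n)
      have "sqrt (real n) ^ J = real n powr (real J / 2)"
        using elim by (simp add: powr_half_sqrt[symmetric] powr_powr flip: powr_realpow)
      then show ?case by (simp add: power_divide power_mult_distrib)
    qed
    ultimately show ?thesis by (simp add: tendsto_cong)
  qed
  ultimately have "(\<lambda>n. real n powr (real J / 2) * ln (1 + \<epsilon> n) + real n powr (real J / 2) * L (1 / (pi * sqrt n))) \<longlonglongrightarrow> 0 + 0"
    by (rule tendsto_add)
  moreover have "\<forall>\<^sub>F n in sequentially. real n powr (real J / 2) * ln (1 + \<epsilon> n) + real n powr (real J / 2) * L (1 / (pi * sqrt n)) =
      real n powr (real J / 2) * R n"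
    using R_eq by eventually_elim (simp add: distrib_left)
  ultimately show ?thesis by (simp add: tendsto_cong)
qed

theorem corollary1p7:
  fixes r :: nat
  assumes "r \<ge> 1"
  shows "(\<lambda>n. real n powr (real r - 1/2) * (-1) ^ (r - 1) *
              (fwd_diff ^^ r) (\<lambda>m. ln (real (overp m))) n)
         \<longlonglongrightarrow> pi / 2 * pochhammer (1/2) (r - 1)"
proof -
  define s where "s = real r - 1 / 2"
  define a where "a = (\<lambda>j::nat. - 1 / (real j * pi ^ j))"
  \<comment> \<open>With 2 r terms the remainder is o(n^(-r)), half a power better than what
    \<open>fwd_diff_iter_small\<close> requires at s = r - 1/2.\<close>
  define R where "R = (\<lambda>n. ln (real (overp n)) - (pi * sqrt n - ln 8 - ln (real n)
                   - (\<Sum>j=1..2 * r. 1 / (real j * pi ^ j) * real n powr (- real j / 2))))"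
  let ?D = "\<lambda>f n. real n powr s * (fwd_diff ^^ r) f n :: real"
  have split: "ln (real (overp m)) =
     (pi * real m powr (1 / 2) + (-1) * ln (real m) +
       ((\<Sum>j=1..2 * r. a j * real m powr (- real j / 2)) + (R m - ln 8)))" for m
    by (simp add: R_def a_def powr_half_sqrt sum_negf)
  have 1: "?D (\<lambda>m. real m powr (1 / 2)) \<longlonglongrightarrow> 1 / 2 * (-1) ^ (r - 1) * pochhammer (1 / 2) (r - 1)"
    using fwd_diff_iter_powr_tendsto[of r "1 / 2"]
    unfolding prod_half_minus_eq_pochhammer[OF assms] s_def .
  have 2: "?D (\<lambda>m. ln (real m)) \<longlonglongrightarrow> 0"
    unfolding s_def by (rule fwd_diff_iter_ln_tendsto_0[OF assms])
  \<comment> \<open>The \<open>r\<close>-th difference of n^(-j/2) has order at most n^(-j/2 - r), a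
    factor n^(-(j+1)/2) below the scale n^(-s).\<close>
  have 3: "?D (\<lambda>m. a j * real m powr (- real j / 2)) \<longlonglongrightarrow> 0" if "j \<ge> 1" for j
  proof -
    have "(\<lambda>n. a j * (real n powr (- (1 / 2) - real j / 2) *
             (real n powr (real r - (- real j / 2)) * (fwd_diff ^^ r) (\<lambda>m. real m powr (- real j / 2)) n)))
          \<longlonglongrightarrow> a j * (0 * (\<Prod>i<r. - real j / 2 - real i))"
      by (intro tendsto_mult_left tendsto_mult fwd_diff_iter_powr_tendsto) real_asymp
    moreover have "a j * (real n powr (- (1 / 2) - real j / 2) *
             (real n powr (real r - (- real j / 2)) * (fwd_diff ^^ r) (\<lambda>m. real m powr (- real j / 2)) n)) =
          ?D (\<lambda>m. a j * real m powr (- real j / 2)) n" for n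
    proof -
      have "s = (- (1 / 2) - real j / 2) + (real r - (- real j / 2))" by (simp add: s_def)
      then have "real n powr s = real n powr (- (1 / 2) - real j / 2) * real n powr (real r - (- real j / 2))"
        by (simp only: powr_add)
      then show ?thesis unfolding fwd_diff_iter_linear(2) by (simp only: mult_ac)
    qed
    ultimately show ?thesis by simp
  qed
  \<comment> \<open>The constant ln 8 is not small, so \<open>fwd_diff_iter_small\<close> cannot
    absorb it; the first difference removes it, which uses r >= 1.\<close>
  have const: "(fwd_diff ^^ r) (\<lambda>n. R n - ln 8) = (fwd_diff ^^ r) R"
  proof -
    obtain k where "r = Suc k" using assms by (cases r) auto
    moreover have "fwd_diff (\<lambda>n. R n - ln 8) = fwd_diff R" by (simp add: fwd_diff_def fun_eq_iff)
    ultimately show ?thesis by (simp only: funpow_Suc_right o_apply)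
  qed
  have "(\<lambda>n. real n powr (- (1 / 2)) * (real n powr (real (2 * r) / 2) * R n)) \<longlonglongrightarrow> 0 * 0"
    unfolding R_def by (intro tendsto_mult ln_overp_expansion) real_asymp
  then have "(\<lambda>n. real n powr s * R n) \<longlonglongrightarrow> 0"
    by (simp add: mult.assoc[symmetric] powr_add[symmetric] s_def)
  then have 4: "?D (\<lambda>n. R n - ln 8) \<longlonglongrightarrow> 0"
    unfolding const by (rule fwd_diff_iter_small)
  have "(\<lambda>n. (-1) ^ (r - 1) * (pi * ?D (\<lambda>m. real m powr (1 / 2)) n + (-1) * ?D (\<lambda>m. ln (real m)) n
          + ((\<Sum>j=1..2 * r. ?D (\<lambda>m. a j * real m powr (- real j / 2)) n) + ?D (\<lambda>n. R n - ln 8) n))) \<longlonglongrightarrow>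
        (-1) ^ (r - 1) * (pi * (1 / 2 * (-1) ^ (r - 1) * pochhammer (1 / 2) (r - 1)) + (-1) * 0 + ((\<Sum>j=1..2 * r. 0) + 0))"
    by (intro tendsto_mult_left tendsto_add tendsto_sum 1 2 3 4) auto
  moreover have "(-1) ^ (r - 1) * (pi * (1 / 2 * (-1) ^ (r - 1) * pochhammer (1 / 2) (r - 1)) + (-1) * 0 + ((\<Sum>j=1..2 * r. 0) + 0))
       = pi / 2 * pochhammer (1 / 2) (r - 1) * ((-1) ^ (r - 1) * (-1 :: real) ^ (r - 1))" by simp
  moreover have "(-1) ^ (r - 1) * (-1 :: real) ^ (r - 1) = 1"
    by (simp flip: power_mult_distrib)
  moreover have "(-1) ^ (r - 1) * (pi * ?D (\<lambda>m. real m powr (1 / 2)) n + (-1) * ?D (\<lambda>m. ln (real m)) n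
          + ((\<Sum>j=1..2 * r. ?D (\<lambda>m. a j * real m powr (- real j / 2)) n) + ?D (\<lambda>n. R n - ln 8) n)) =
        real n powr (real r - 1/2) * (-1) ^ (r - 1) * (fwd_diff ^^ r) (\<lambda>m. ln (real (overp m))) n" for n
    unfolding split fwd_diff_iter_linear fwd_diff_iter_sum
    by (simp add: s_def fwd_diff_iter_linear fwd_diff_iter_sum algebra_simps sum_distrib_left)
  ultimately show ?thesis by (simp only: mult_1_right)
qed

end
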